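(* Let $q\in\{1,2\}$, and let $z\in P_n[0,T]$, $C\in\mathbb R^{m\times n}$, $b\in\mathbb R^m$. Put $x(t)=x_0+\int_0^t z(\tau)\,d\tau$ and suppose that the trajectories $x_i(t)$, $i=1,\dots,n$, vanish only at isolated time moments of the interval $[0,T]$. Then the functional $I^{[q]}(z,C,b)$ is Gâteaux differentiable at the point $(z,C,b)$ and its gradient there is expressed by the formula $$\nabla I^{[q]}(z,C,b)=\sum_{i=1}^m\Bigg[h_i^{[q]}(x(t),z(t),C,b)\,\mathbf e_i-\int_t^T h_i^{[q]}(x(\tau),z(\tau),C,b)\Big(A_i'+\frac{\partial u_i^{[q]}(x(\tau),C,b)}{\partial x}\Big)d\tau,$$ $$-\int_0^T h_i^{[q]}(x(t),z(t),C,b)\frac{\partial u_i^{[q]}(x(t),C,b)}{\partial C}\,dt,\quad -\int_0^T h_i^{[q]}(x(t),z(t),C,b)\frac{\partial u_i^{[q]}(x(t),C,b)}{\partial b}\,dt\Bigg]$$ $$+\Bigg[\sum_{i=m+1}^n\Big(h_i(x(t),z(t))\,\mathbf e_i-\int_t^T h_i(x(\tau),z(\tau))A_i'\,d\tau\Big),\ \mathbf 0_{m\times n},\ \mathbf 0_m\Bigg]$$ $$+\Bigg[\sum_{j\in J}\Big({x_0}_j+\int_0^T z_j(t)\,dt-{x_T}_j\Big)\mathbf e_j,\ \mathbf 0_{m\times n},\ \mathbf 0_m\Bigg].$$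
   Context: $P_n[0,T]$ is the space of piecewise continuous and bounded $n$-dimensional vector-functions on $[0,T]$. The gradient is an element of $P_n[0,T]\times\mathbb R^{m\times n}\times\mathbb R^m$, written $[\,\cdot,\cdot,\cdot\,]$ with its first component a function of $t$; it represents the Gâteaux derivative with respect to the $L^2$ inner product in $z$ and the Euclidean inner products in $C$ and $b$. $\mathbf e_1,\dots,\mathbf e_n$ is the standard basis of $\mathbb R^n$; $'$ denotes transposition; $|x|=\sum_{j=1}^n|x_j|$. Data: integers $m\le n$; a constant real $n\times n$ matrix $A$ with rows $A_1,\dots,A_n$; a point $x_0\in\mathbb R^n$; an index set $J\subset\{1,\dots,n\}$ and numbers ${x_T}_j$, $j\in J$; a time $T>0$; fixed numbers $\alpha_1,\dots,\alpha_m>0$; a number $\delta>0$. For $C\in\mathbb R^{m\times n}$ and $b\in\mathbb R^m$ let $s(x)=Cx-b$, with components $s_1,\dots,s_m$. For $i=1,\dots,m$ define $$u_i^{[1]}(x,C,b)=-\alpha_i|x|\,s_i(x)\exp\{\mathrm{sign}(s_i(x))(-s_i(x))\},$$ $$u_i^{[2]}(x,C,b)=\begin{cases}\alpha_i|x|\,k\sqrt{-s_i(x)},& s_i(x)\le-\delta,\\ -\alpha_i|x|\,(e\,s_i^3(x)+f\,s_i(x)),&-\delta\le s_i(x)\le\delta,\\ -\alpha_i|x|\,k\sqrt{s_i(x)},& s_i(x)\ge\delta,\end{cases}$$ where the real parameters $k,e,f$ are chosen so that $u_i^{[2]}$ is continuously differentiable at points with $x_j\ne0$ for all $j=1,\dots,n$.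 For $q\in\{1,2\}$ define $$h_i^{[q]}(x,z,C,b)=z_i-A_ix-u_i^{[q]}(x,C,b)\ (i=1,\dots,m),\qquad h_i(x,z)=z_i-A_ix\ (i=m+1,\dots,n),$$ and, with $x(t)=x_0+\int_0^tz(\tau)\,d\tau$, $$\varphi^{[q]}(z,C,b)=\frac12\sum_{i=1}^m\int_0^T\big(h_i^{[q]}(x(t),z(t),C,b)\big)^2dt+\frac12\sum_{i=m+1}^n\int_0^T h_i^2(x(t),z(t))\,dt,$$ $$\chi(z)=\frac12\sum_{j\in J}\Big({x_0}_j+\int_0^Tz_j(t)\,dt-{x_T}_j\Big)^2,\qquad I^{[q]}(z,C,b)=\varphi^{[q]}(z,C,b)+\chi(z).$$ *)

theory Defs
  imports "HOL-Analysis.Analysis"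
begin

text \<open>
  The state space is \<open>real^'n\<close> and there are \<open>CARD('m)\<close> controls.  The inclusion of the index set
  \<open>{1..m}\<close> into \<open>{1..n}\<close> is represented by an injection \<open>\<iota> :: 'm \<Rightarrow> 'n\<close> (so \<open>m \<le> n\<close>): the \<open>i\<close>-th
  control enters the \<open>\<iota> i\<close>-th equation, and \<open>- range \<iota>\<close> plays the role of \<open>{m+1..n}\<close>.
  Only the restrictions to \<open>{0..T}\<close> of functions of time matter.
\<close>

definition norm1 :: "real^'n \<Rightarrow> real" where
  "norm1 x = (\<Sum>j\<in>UNIV. \<bar>x $ j\<bar>)"

text \<open>Discontinuities are confined to a finite set; one-sided limits there are not required to exist,
  which is why boundedness is a separate condition.\<close>

definition pc_bounded :: "real \<Rightarrow> (real \<Rightarrow> real^'n) \<Rightarrow> bool" where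
  "pc_bounded T z \<longleftrightarrow>
     (\<exists>S. finite S \<and> continuous_on ({0..T} - S) z) \<and> bounded (z ` {0..T})"

text \<open>The vector (or matrix) of partial derivatives; unspecified where \<open>f\<close> is not differentiable.\<close>

definition grad :: "('a::real_inner \<Rightarrow> real) \<Rightarrow> 'a \<Rightarrow> 'a" where
  "grad f x = (THE D. GDERIV f x :> D)"

definition continuously_differentiable_on :: "('a::real_inner \<Rightarrow> real) \<Rightarrow> 'a set \<Rightarrow> bool" where
  "continuously_differentiable_on f S \<longleftrightarrow>
     (\<exists>G. continuous_on S G \<and> (\<forall>x\<in>S. GDERIV f x :> G x))"

definition surf :: "'m \<Rightarrow> real^'n \<Rightarrow> real^'n^'m \<Rightarrow> real^'m \<Rightarrow> real" where
  "surf i x C b = (C *v x - b) $ i"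

definition control1 :: "('m \<Rightarrow> real) \<Rightarrow> 'm \<Rightarrow> real^'n \<Rightarrow> real^'n^'m \<Rightarrow> real^'m \<Rightarrow> real" where
  "control1 \<alpha> i x C b =
     - \<alpha> i * norm1 x * surf i x C b * exp (sgn (surf i x C b) * (- surf i x C b))"

text \<open>The branches overlap at \<open>\<plusminus>\<delta>\<close>; they agree there for the admissible parameters \<open>k\<close>, \<open>e\<close>, \<open>f\<close>,
  since otherwise the function would be discontinuous.\<close>

definition control2 ::
  "('m \<Rightarrow> real) \<Rightarrow> real \<Rightarrow> real \<Rightarrow> real \<Rightarrow> real \<Rightarrow> 'm \<Rightarrow> real^'n \<Rightarrow> real^'n^'m \<Rightarrow> real^'m \<Rightarrow> real" where
  "control2 \<alpha> \<delta> k e f i x C b =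
     (let s = surf i x C b in
      if s \<le> - \<delta> then \<alpha> i * norm1 x * k * sqrt (- s)
      else if s \<le> \<delta> then - \<alpha> i * norm1 x * (e * s ^ 3 + f * s)
      else - \<alpha> i * norm1 x * k * sqrt s)"

definition admissible_parameters ::
  "('m::finite \<Rightarrow> real) \<Rightarrow> real \<Rightarrow> real \<Rightarrow> real \<Rightarrow> real \<Rightarrow> 'n::finite itself \<Rightarrow> bool" where
  "admissible_parameters \<alpha> \<delta> k e f _ \<longleftrightarrow>
     (\<forall>i. continuously_differentiable_on
        (\<lambda>(x :: real^'n, C :: real^'n^'m, b :: real^'m). control2 \<alpha> \<delta> k e f i x C b)
        {(x, C, b). \<forall>j. x $ j \<noteq> 0})"

definition control ::
  "nat \<Rightarrow> ('m \<Rightarrow> real) \<Rightarrow> real \<Rightarrow> real \<Rightarrow> real \<Rightarrow> real \<Rightarrow>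
   'm \<Rightarrow> real^'n \<Rightarrow> real^'n^'m \<Rightarrow> real^'m \<Rightarrow> real" where
  "control q \<alpha> \<delta> k e f = (if q = 1 then control1 \<alpha> else control2 \<alpha> \<delta> k e f)"

definition trajectory :: "real^'n \<Rightarrow> (real \<Rightarrow> real^'n) \<Rightarrow> real \<Rightarrow> real^'n" where
  "trajectory x0 z t = x0 + integral {0..t} z"

text \<open>In the definitions below \<open>u\<close> stands for the family of controls, \<open>u i x C b\<close>.\<close>

definition h_ctrl ::
  "('m \<Rightarrow> 'n) \<Rightarrow> real^'n^'n \<Rightarrow> ('m \<Rightarrow> real^'n \<Rightarrow> real^'n^'m \<Rightarrow> real^'m \<Rightarrow> real) \<Rightarrow>
   'm \<Rightarrow> real^'n \<Rightarrow> real^'n \<Rightarrow> real^'n^'m \<Rightarrow> real^'m \<Rightarrow> real" where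
  "h_ctrl \<iota> A u i x z C b = z $ \<iota> i - A $ \<iota> i \<bullet> x - u i x C b"

definition h_free :: "real^'n^'n \<Rightarrow> 'n \<Rightarrow> real^'n \<Rightarrow> real^'n \<Rightarrow> real" where
  "h_free A j x z = z $ j - A $ j \<bullet> x"

definition phi ::
  "real \<Rightarrow> real^'n \<Rightarrow> ('m::finite \<Rightarrow> 'n) \<Rightarrow> real^'n^'n \<Rightarrow>
   ('m \<Rightarrow> real^'n \<Rightarrow> real^'n^'m \<Rightarrow> real^'m \<Rightarrow> real) \<Rightarrow>
   (real \<Rightarrow> real^'n) \<Rightarrow> real^'n^'m \<Rightarrow> real^'m \<Rightarrow> real" where
  "phi T x0 \<iota> A u z C b =
     1/2 * (\<Sum>i\<in>UNIV. integral {0..T} (\<lambda>t. (h_ctrl \<iota> A u i (trajectory x0 z t) (z t) C b)\<^sup>2)) +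
     1/2 * (\<Sum>j\<in>- range \<iota>. integral {0..T} (\<lambda>t. (h_free A j (trajectory x0 z t) (z t))\<^sup>2))"

definition chi ::
  "real \<Rightarrow> real^'n \<Rightarrow> 'n set \<Rightarrow> ('n \<Rightarrow> real) \<Rightarrow> (real \<Rightarrow> real^'n) \<Rightarrow> real" where
  "chi T x0 J xT z = 1/2 * (\<Sum>j\<in>J. (x0 $ j + integral {0..T} (\<lambda>t. z t $ j) - xT j)\<^sup>2)"

definition functional_I ::
  "real \<Rightarrow> real^'n \<Rightarrow> 'n set \<Rightarrow> ('n \<Rightarrow> real) \<Rightarrow> ('m::finite \<Rightarrow> 'n) \<Rightarrow> real^'n^'n \<Rightarrow>
   ('m \<Rightarrow> real^'n \<Rightarrow> real^'n^'m \<Rightarrow> real^'m \<Rightarrow> real) \<Rightarrow>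
   (real \<Rightarrow> real^'n) \<Rightarrow> real^'n^'m \<Rightarrow> real^'m \<Rightarrow> real" where
  "functional_I T x0 J xT \<iota> A u z C b = phi T x0 \<iota> A u z C b + chi T x0 J xT z"

text \<open>\<open>F\<close> is Gateaux differentiable at \<open>(z, C, b)\<close> with gradient \<open>[g, G, \<gamma>]\<close>.  On \<open>real^'n^'m\<close> the
  operation \<open>\<bullet>\<close> is the entrywise (Frobenius) inner product.\<close>

definition has_gateaux_gradient ::
  "real \<Rightarrow> ((real \<Rightarrow> real^'n) \<Rightarrow> real^'n^'m \<Rightarrow> real^'m \<Rightarrow> real) \<Rightarrow>
   (real \<Rightarrow> real^'n) \<times> (real^'n^'m) \<times> (real^'m) \<Rightarrow>
   (real \<Rightarrow> real^'n) \<times> (real^'n^'m) \<times> (real^'m) \<Rightarrow> bool" where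
  "has_gateaux_gradient T F = (\<lambda>(z, C, b) (g, G, \<gamma>).
     pc_bounded T g \<and>
     (\<forall>v D d. pc_bounded T v \<longrightarrow>
        ((\<lambda>r. (F (\<lambda>t. z t + r *\<^sub>R v t) (C + r *\<^sub>R D) (b + r *\<^sub>R d) - F z C b) / r)
           \<longlongrightarrow> integral {0..T} (\<lambda>t. g t \<bullet> v t) + G \<bullet> D + \<gamma> \<bullet> d) (at 0)))"

end

theory Submission
  imports Defs
begin

text \<open>
  Both controls have the form \<open>\<alpha>\<^sub>i |x| \<psi>(s\<^sub>i(x))\<close> with a continuously differentiable \<open>\<psi>\<close>, so
  nondifferentiability comes only from \<open>|x|\<close>, at the zeros of the coordinates of the trajectory.
  These zeros are isolated and form a compact set, hence there are finitely many of them. Along a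
  direction \<open>(v, D, d)\<close> the integrands therefore have a derivative in the parameter \<open>r\<close> at all but finitely many
  times, and they are Lipschitz in \<open>r\<close> uniformly in time, so dominated convergence allows
  differentiation under the integral sign. The state is varied by \<open>y(t) = \<integral>\<^sub>0\<^sup>t v\<close>, and integration by
  parts moves this integral onto the coefficients of \<open>y\<close>, which yields the terms \<open>\<integral>\<^sub>t\<^sup>T\<close> of the gradient.
\<close>

section \<open>Piecewise continuous bounded functions\<close>

text \<open>This is \<open>pc_bounded\<close> with an arbitrary normed codomain, so that scalar
  residuals, matrix-valued gradients and pairs share one calculus.\<close>

definition piecewise_cont_bounded :: "real \<Rightarrow> (real \<Rightarrow> 'a::real_normed_vector) \<Rightarrow> bool" where
  "piecewise_cont_bounded T f \<longleftrightarrow>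
     (\<exists>S. finite S \<and> continuous_on ({0..T} - S) f) \<and> bounded (f ` {0..T})"

lemma pc_bounded_iff: "pc_bounded T z \<longleftrightarrow> piecewise_cont_bounded T z"
  by (simp add: pc_bounded_def piecewise_cont_bounded_def)

lemma pcb_bound:
  assumes "piecewise_cont_bounded T f"
  shows "\<exists>M\<ge>0. \<forall>t. t \<in> {0..T} \<longrightarrow> norm (f t) \<le> M"
proof -
  obtain M where "\<forall>t\<in>{0..T}. norm (f t) \<le> M"
    using assms unfolding piecewise_cont_bounded_def bounded_iff by blast
  then show ?thesis
    by (intro exI[of _ "\<bar>M\<bar>"]) force
qed

lemma pcb_continuous:
  assumes "continuous_on {0..T} f"
  shows "piecewise_cont_bounded T f"
  unfolding piecewise_cont_bounded_def
proof
  show "\<exists>S. finite S \<and> continuous_on ({0..T} - S) f"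
    using assms by (intro exI[of _ "{}"]) simp
  show "bounded (f ` {0..T})"
    by (rule compact_imp_bounded[OF compact_continuous_image[OF assms compact_Icc]])
qed

lemma pcb_const: "piecewise_cont_bounded T (\<lambda>t. c)"
  by (intro pcb_continuous continuous_intros)

text \<open>The values of \<open>f\<close> lie in a compact set, the closure of its bounded range,
  and the continuous \<open>g\<close> is bounded there. Composition adds no new
  discontinuities.\<close>

lemma pcb_compose:
  fixes f :: "real \<Rightarrow> 'a::{real_normed_vector, heine_borel}"
  assumes f: "piecewise_cont_bounded T f" and g: "continuous_on UNIV g"
  shows "piecewise_cont_bounded T (\<lambda>t. g (f t))"
proof -
  obtain S where S: "finite S" "continuous_on ({0..T} - S) f"
    using f by (auto simp: piecewise_cont_bounded_def)
  have "compact (closure (f ` {0..T}))"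
    using f by (auto simp: piecewise_cont_bounded_def compact_eq_bounded_closed bounded_closure)
  then have "bounded (g ` closure (f ` {0..T}))"
    by (intro compact_imp_bounded compact_continuous_image continuous_on_subset[OF g]) auto
  then have "bounded ((\<lambda>t. g (f t)) ` {0..T})"
    by (rule bounded_subset) (use closure_subset in fastforce)
  moreover have "continuous_on ({0..T} - S) (\<lambda>t. g (f t))"
    by (rule continuous_on_compose2[OF g S(2)]) auto
  ultimately show ?thesis
    using S(1) by (auto simp: piecewise_cont_bounded_def)
qed

lemma pcb_Pair:
  assumes "piecewise_cont_bounded T f" "piecewise_cont_bounded T g"
  shows "piecewise_cont_bounded T (\<lambda>t. (f t, g t))"
proof -
  obtain S1 S2 where S: "finite S1" "continuous_on ({0..T} - S1) f"
      "finite S2" "continuous_on ({0..T} - S2) g"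
    using assms by (auto simp: piecewise_cont_bounded_def)
  have "continuous_on ({0..T} - (S1 \<union> S2)) (\<lambda>t. (f t, g t))"
    by (intro continuous_on_Pair continuous_on_subset[OF S(2)] continuous_on_subset[OF S(4)]) auto
  moreover have "bounded ((\<lambda>t. (f t, g t)) ` {0..T})"
    by (rule bounded_subset[of "f ` {0..T} \<times> g ` {0..T}"])
       (use assms in \<open>auto simp: piecewise_cont_bounded_def intro: bounded_Times\<close>)
  ultimately show ?thesis
    unfolding piecewise_cont_bounded_def using S by (intro conjI exI[of _ "S1 \<union> S2"]) auto
qed

text \<open>Pairing reduces a binary operation to the unary case; the rules for sums, differences,
  scalings and inner products then need only joint continuity.\<close>

lemma pcb_compose2:
  fixes f :: "real \<Rightarrow> 'a::euclidean_space" and g :: "real \<Rightarrow> 'b::euclidean_space"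
  assumes "piecewise_cont_bounded T f" "piecewise_cont_bounded T g"
    and "continuous_on UNIV (\<lambda>p. h (fst p) (snd p))"
  shows "piecewise_cont_bounded T (\<lambda>t. h (f t) (g t))"
  using pcb_compose[OF pcb_Pair[OF assms(1,2)] assms(3)] by simp

lemma pcb_add:
  fixes f g :: "real \<Rightarrow> 'a::euclidean_space"
  assumes "piecewise_cont_bounded T f" "piecewise_cont_bounded T g"
  shows "piecewise_cont_bounded T (\<lambda>t. f t + g t)"
  by (rule pcb_compose2[OF assms, where h = "(+)"]) (intro continuous_intros)

lemma pcb_diff:
  fixes f g :: "real \<Rightarrow> 'a::euclidean_space"
  assumes "piecewise_cont_bounded T f" "piecewise_cont_bounded T g"
  shows "piecewise_cont_bounded T (\<lambda>t. f t - g t)"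
  by (rule pcb_compose2[OF assms, where h = "(-)"]) (intro continuous_intros)

lemma pcb_scaleR:
  fixes g :: "real \<Rightarrow> 'a::euclidean_space"
  assumes "piecewise_cont_bounded T f" "piecewise_cont_bounded T g"
  shows "piecewise_cont_bounded T (\<lambda>t. f t *\<^sub>R g t)"
  by (rule pcb_compose2[OF assms, where h = scaleR]) (intro continuous_intros)

lemma pcb_mult:
  fixes f g :: "real \<Rightarrow> real"
  assumes "piecewise_cont_bounded T f" "piecewise_cont_bounded T g"
  shows "piecewise_cont_bounded T (\<lambda>t. f t * g t)"
  using pcb_scaleR[OF assms] by simp

lemma pcb_inner:
  fixes f g :: "real \<Rightarrow> 'a::euclidean_space"
  assumes "piecewise_cont_bounded T f" "piecewise_cont_bounded T g"
  shows "piecewise_cont_bounded T (\<lambda>t. f t \<bullet> g t)"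
  by (rule pcb_compose2[OF assms, where h = "(\<bullet>)"]) (intro continuous_intros)

lemma pcb_sum:
  fixes f :: "'i \<Rightarrow> real \<Rightarrow> 'a::euclidean_space"
  assumes "\<And>i. i \<in> I \<Longrightarrow> piecewise_cont_bounded T (f i)"
  shows "piecewise_cont_bounded T (\<lambda>t. \<Sum>i\<in>I. f i t)"
  using assms by (induction I rule: infinite_finite_induct) (auto intro: pcb_const pcb_add)

lemma pcb_nth:
  fixes f :: "real \<Rightarrow> real^'n"
  assumes "piecewise_cont_bounded T f"
  shows "piecewise_cont_bounded T (\<lambda>t. f t $ j)"
  by (rule pcb_compose[OF assms, where g = "\<lambda>x. x $ j"]) (intro continuous_intros)

text \<open>Finitely many arbitrary values affect neither boundedness nor continuity off a finite
  set. This accommodates \<open>grad\<close> at zeros of a state coordinate, where its value may be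
  unspecified.\<close>

lemma pcb_spike:
  assumes f: "piecewise_cont_bounded T f" and N: "finite N"
    and eq: "\<And>t. t \<in> {0..T} - N \<Longrightarrow> g t = f t"
  shows "piecewise_cont_bounded T g"
proof -
  obtain S where S: "finite S" "continuous_on ({0..T} - S) f"
    using f by (auto simp: piecewise_cont_bounded_def)
  have "continuous_on ({0..T} - (S \<union> N)) g"
    by (rule continuous_on_eq[OF continuous_on_subset[OF S(2)]]) (auto simp: eq)
  moreover have "bounded (g ` {0..T})"
  proof (rule bounded_subset)
    show "bounded (f ` {0..T} \<union> g ` N)"
      using f N by (auto simp: piecewise_cont_bounded_def finite_imp_bounded)
    show "g ` {0..T} \<subseteq> f ` {0..T} \<union> g ` N"
      using eq by (auto simp: image_iff) force
  qed
  ultimately show ?thesis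
    unfolding piecewise_cont_bounded_def using S N by (intro conjI exI[of _ "S \<union> N"]) auto
qed

lemma pcb_sgn:
  fixes f :: "real \<Rightarrow> real"
  assumes f: "continuous_on {0..T} f" and fin: "finite {t \<in> {0..T}. f t = 0}"
  shows "piecewise_cont_bounded T (\<lambda>t. sgn (f t))"
  unfolding piecewise_cont_bounded_def
proof
  have "continuous_on ({0..T} - {t \<in> {0..T}. f t = 0}) (\<lambda>t. sgn (f t))"
    by (intro continuous_on_sgn continuous_on_subset[OF f]) auto
  with fin show "\<exists>S. finite S \<and> continuous_on ({0..T} - S) (\<lambda>t. sgn (f t))"
    by blast
  show "bounded ((\<lambda>t. sgn (f t)) ` {0..T})"
    by (rule boundedI[of _ 1]) (auto simp: sgn_real_def)
qed

section \<open>Integrability and integration by parts\<close>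

lemma integrable_on_minus_finite:
  fixes f :: "'a::euclidean_space \<Rightarrow> 'b::banach"
  assumes "finite N"
  shows "f integrable_on (A - N) \<longleftrightarrow> f integrable_on A"
proof (rule integrable_spike_set_eq)
  have "(A - N - A) \<union> (A - (A - N)) \<subseteq> N"
    by blast
  then show "negligible ((A - N - A) \<union> (A - (A - N)))"
    by (rule negligible_finite[OF finite_subset[OF _ assms]])
qed

text \<open>Off the exceptional set \<open>f\<close> is continuous, hence measurable, and it is
  dominated by a constant. The exceptional set is negligible, so it can be restored.\<close>

lemma pcb_integrable:
  fixes f :: "real \<Rightarrow> 'a::euclidean_space"
  assumes "piecewise_cont_bounded T f"
  shows "f integrable_on {0..T}"
proof -
  obtain S where S: "finite S" "continuous_on ({0..T} - S) f"
    using assms by (auto simp: piecewise_cont_bounded_def)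
  obtain M where M: "M \<ge> 0" "\<And>t. t \<in> {0..T} \<Longrightarrow> norm (f t) \<le> M"
    using pcb_bound[OF assms] by auto
  have sets: "{0..T} - S \<in> sets lebesgue"
    by (rule sets.Diff[OF _ negligible_imp_sets[OF negligible_finite[OF S(1)]]]) simp
  have "(\<lambda>_. M) integrable_on {0..T} - S"
    by (simp only: integrable_on_minus_finite[OF S(1)] integrable_const_ivl)
  then have "f integrable_on {0..T} - S"
    by (rule measurable_bounded_by_integrable_imp_integrable[OF
        continuous_imp_measurable_on_sets_lebesgue[OF S(2) sets] _ _ sets]) (simp add: M(2))
  then show ?thesis
    by (simp only: integrable_on_minus_finite[OF S(1)])
qed

lemma pcb_integral_upper:
  fixes f :: "real \<Rightarrow> 'a::euclidean_space"
  assumes "piecewise_cont_bounded T f"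
  shows "piecewise_cont_bounded T (\<lambda>t. integral {t..T} f)"
  by (rule pcb_continuous[OF indefinite_integral_continuous_1'[OF pcb_integrable[OF assms]]])

lemma pcb_indefinite_integral_derivative:
  fixes f :: "real \<Rightarrow> 'a::euclidean_space"
  assumes "piecewise_cont_bounded T f"
  shows "\<exists>S. finite S \<and> (\<forall>t. t \<in> {0<..<T} - S \<longrightarrow>
    ((\<lambda>u. integral {0..u} f) has_vector_derivative f t) (at t))"
proof -
  obtain S where S: "finite S" "continuous_on ({0..T} - S) f"
    using assms by (auto simp: piecewise_cont_bounded_def)
  have "((\<lambda>u. integral {0..u} f) has_vector_derivative f t) (at t)"
    if t: "t \<in> {0<..<T} - S" for t
  proof -
    have "((\<lambda>u. integral {0..u} f) has_vector_derivative f t) (at t within ({0..T} - S))"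
    proof (rule integral_has_vector_derivative_continuous_at)
      show "f integrable_on {0..T}"
        by (rule pcb_integrable[OF assms])
      show tS: "t \<in> {0..T} - S" and "finite S"
        using t S(1) by auto
      show "continuous (at t within {0..T} - S) f"
        using S(2) tS continuous_on_eq_continuous_within by blast
    qed
    then have "((\<lambda>u. integral {0..u} f) has_vector_derivative f t) (at t within ({0<..<T} - S))"
      by (rule has_vector_derivative_within_subset) auto
    \<comment> \<open>Removing a finite set from an open interval leaves an open set, so the
      derivative within it is the two-sided one.\<close>
    moreover have "open ({0<..<T} - S)"
      by (intro open_Diff open_greaterThanLessThan finite_imp_closed S(1))
    ultimately show ?thesis
      by (simp only: at_within_open[OF t])
  qed
  with S(1) show ?thesis
    by (intro exI[of _ S]) simp
qed

text \<open>Integration by parts, with one antiderivative vanishing at \<open>T\<close> and the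
  other at \<open>0\<close>, so that both boundary terms disappear.\<close>

lemma integral_inner_indefinite_integral:
  fixes p v :: "real \<Rightarrow> 'a::euclidean_space"
  assumes "T \<ge> 0" and p: "piecewise_cont_bounded T p" and v: "piecewise_cont_bounded T v"
  shows "integral {0..T} (\<lambda>t. p t \<bullet> integral {0..t} v) =
         integral {0..T} (\<lambda>t. integral {t..T} p \<bullet> v t)"
proof -
  \<comment> \<open>On \<open>{0..T}\<close> this is the tail integral of \<open>p\<close>; written
    as a constant minus an indefinite integral, it visibly has derivative
    \<open>- p\<close>.\<close>
  define P where "P = (\<lambda>t. integral {0..T} p - integral {0..t} p)"
  define V where "V = (\<lambda>t. integral {0..t} v)"
  have P_eq: "integral {t..T} p = P t" if "t \<in> {0..T}" for t
    using that Henstock_Kurzweil_Integration.integral_combine[where a = 0 and c = t and b = T and f = p] pcb_integrable[OF p]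
    by (simp add: P_def algebra_simps)
  have contP: "continuous_on {0..T} P" and contV: "continuous_on {0..T} V"
    unfolding P_def V_def
    by (intro continuous_intros indefinite_integral_continuous_1 pcb_integrable p v)+
  obtain S1 where S1: "finite S1"
    "\<And>t. t \<in> {0<..<T} - S1 \<Longrightarrow> ((\<lambda>u. integral {0..u} p) has_vector_derivative p t) (at t)"
    using pcb_indefinite_integral_derivative[OF p] by auto
  obtain S2 where S2: "finite S2"
    "\<And>t. t \<in> {0<..<T} - S2 \<Longrightarrow> (V has_vector_derivative v t) (at t)"
    using pcb_indefinite_integral_derivative[OF v] unfolding V_def by auto
  have "((\<lambda>t. P t \<bullet> v t + (- p t) \<bullet> V t) has_integral (P T \<bullet> V T - P 0 \<bullet> V 0)) {0..T}"
  \<comment> \<open>The antiderivative is continuous on the whole interval, so its derivative may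
    fail to exist at the finitely many points of \<open>S1 \<union> S2\<close>.\<close>
  proof (rule fundamental_theorem_of_calculus_interior_strong[of "S1 \<union> S2"])
    fix t assume t: "t \<in> {0<..<T} - (S1 \<union> S2)"
    have "(P has_vector_derivative - p t) (at t)"
      unfolding P_def using S1(2)[of t] t
      by (auto intro!: derivative_eq_intros)
    moreover have "(V has_vector_derivative v t) (at t)"
      using S2(2) t by auto
    ultimately show "((\<lambda>t. P t \<bullet> V t) has_vector_derivative P t \<bullet> v t + (- p t) \<bullet> V t) (at t)"
      by (rule bounded_bilinear.has_vector_derivative[OF bounded_bilinear_inner])
  qed (use S1 S2 \<open>T \<ge> 0\<close> in \<open>auto intro!: continuous_intros contP contV\<close>)
  moreover have "P T = 0" "V 0 = 0"
    by (simp_all add: P_def V_def)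
  ultimately have "((\<lambda>t. P t \<bullet> v t - p t \<bullet> V t) has_integral 0) {0..T}"
    by simp
  moreover have "(\<lambda>t. P t \<bullet> v t) integrable_on {0..T}" "(\<lambda>t. p t \<bullet> V t) integrable_on {0..T}"
    by (intro pcb_integrable pcb_inner pcb_continuous contP contV p v)+
  ultimately have "integral {0..T} (\<lambda>t. P t \<bullet> v t) - integral {0..T} (\<lambda>t. p t \<bullet> V t) = 0"
    by (simp only: integral_diff[symmetric] integral_unique)
  moreover have "integral {0..T} (\<lambda>t. integral {t..T} p \<bullet> v t) = integral {0..T} (\<lambda>t. P t \<bullet> v t)"
    by (rule integral_cong) (simp add: P_eq)
  ultimately show ?thesis
    by (simp add: V_def)
qed

section \<open>Differentiation of integrals depending on a parameter\<close>

text \<open>These are the conditions for differentiating under the integral at \<open>r = 0\<close>: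
  the Lipschitz constant, uniform in \<open>t\<close>, dominates the difference quotients, and
  pointwise derivatives may be missing at finitely many times. The restriction to
  \<open>\<bar>r\<bar> \<le> 1\<close> keeps all values in one bounded range, as products and
  compositions require.\<close>

definition variation :: "real \<Rightarrow> (real \<Rightarrow> real \<Rightarrow> real) \<Rightarrow> (real \<Rightarrow> real) \<Rightarrow> bool" where
  "variation T Q Q' \<longleftrightarrow>
     (\<forall>r. piecewise_cont_bounded T (Q r)) \<and>
     (\<exists>L. \<forall>t\<in>{0..T}. \<forall>r. \<bar>r\<bar> \<le> 1 \<longrightarrow> \<bar>Q r t - Q 0 t\<bar> \<le> L * \<bar>r\<bar>) \<and>
     (\<exists>N. finite N \<and> (\<forall>t\<in>{0..T} - N. ((\<lambda>r. Q r t) has_real_derivative Q' t) (at 0)))"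

lemma variationI:
  assumes "\<And>r. piecewise_cont_bounded T (Q r)"
    and "\<And>t r. t \<in> {0..T} \<Longrightarrow> \<bar>r\<bar> \<le> 1 \<Longrightarrow> \<bar>Q r t - Q 0 t\<bar> \<le> L * \<bar>r\<bar>"
    and "finite N" and "\<And>t. t \<in> {0..T} - N \<Longrightarrow> ((\<lambda>r. Q r t) has_real_derivative Q' t) (at 0)"
  shows "variation T Q Q'"
  unfolding variation_def using assms
  by (intro conjI allI exI[of _ L] exI[of _ N] ballI impI) simp_all

lemma variation_pcb: "variation T Q Q' \<Longrightarrow> piecewise_cont_bounded T (Q r)"
  by (simp add: variation_def)

lemma variation_lipschitz:
  assumes "variation T Q Q'"
  shows "\<exists>L\<ge>0. \<forall>t r. t \<in> {0..T} \<longrightarrow> \<bar>r\<bar> \<le> 1 \<longrightarrow> \<bar>Q r t - Q 0 t\<bar> \<le> L * \<bar>r\<bar>"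
proof -
  obtain L where L: "\<forall>t\<in>{0..T}. \<forall>r. \<bar>r\<bar> \<le> 1 \<longrightarrow> \<bar>Q r t - Q 0 t\<bar> \<le> L * \<bar>r\<bar>"
    using assms by (auto simp: variation_def)
  have "\<bar>Q r t - Q 0 t\<bar> \<le> \<bar>L\<bar> * \<bar>r\<bar>" if "t \<in> {0..T}" "\<bar>r\<bar> \<le> 1" for t r
  proof -
    have "\<bar>Q r t - Q 0 t\<bar> \<le> L * \<bar>r\<bar>"
      using L that by blast
    also have "\<dots> \<le> \<bar>L\<bar> * \<bar>r\<bar>"
      by (intro mult_right_mono) auto
    finally show ?thesis .
  qed
  then show ?thesis
    by (intro exI[of _ "\<bar>L\<bar>"]) simp
qed

lemma variation_bound:
  assumes "variation T Q Q'"
  shows "\<exists>M\<ge>0. \<forall>t r. t \<in> {0..T} \<longrightarrow> \<bar>r\<bar> \<le> 1 \<longrightarrow> \<bar>Q r t\<bar> \<le> M"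
proof -
  obtain L where L: "L \<ge> 0" "\<And>t r. t \<in> {0..T} \<Longrightarrow> \<bar>r\<bar> \<le> 1 \<Longrightarrow> \<bar>Q r t - Q 0 t\<bar> \<le> L * \<bar>r\<bar>"
    using variation_lipschitz[OF assms] by auto
  obtain M where M: "M \<ge> 0" "\<And>t. t \<in> {0..T} \<Longrightarrow> norm (Q 0 t) \<le> M"
    using pcb_bound[OF variation_pcb[OF assms]] by auto
  have "\<bar>Q r t\<bar> \<le> M + L" if "t \<in> {0..T}" "\<bar>r\<bar> \<le> 1" for t r
  proof -
    have "\<bar>Q r t - Q 0 t\<bar> \<le> L"
      using L(2)[OF that] mult_left_mono[OF that(2) L(1)] by simp
    moreover have "\<bar>Q 0 t\<bar> \<le> M"
      using M(2)[OF that(1)] by simp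
    ultimately show ?thesis
      by linarith
  qed
  then show ?thesis
    using L M by (intro exI[of _ "M + L"]) simp
qed

lemma variation_deriv:
  assumes "variation T Q Q'"
  shows "\<exists>N. finite N \<and>
    (\<forall>t. t \<in> {0..T} - N \<longrightarrow> ((\<lambda>r. Q r t) has_real_derivative Q' t) (at 0))"
  using assms unfolding variation_def by blast

text \<open>The derivative may be altered on a finite set, because \<open>variation\<close>
  constrains it only off such a set. This lets a formula in terms of \<open>grad\<close> replace the
  explicit derivative of a control.\<close>

lemma variation_cong:
  assumes "variation T Q Q'" and "finite N"
    and Q: "\<And>r t. t \<in> {0..T} \<Longrightarrow> P r t = Q r t" 
    and Q': "\<And>t. t \<in> {0..T} - N \<Longrightarrow> P' t = Q' t"
  shows "variation T P P'"
proof -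
  obtain N' where N': "finite N'"
    "\<And>t. t \<in> {0..T} - N' \<Longrightarrow> ((\<lambda>r. Q r t) has_real_derivative Q' t) (at 0)"
    using variation_deriv[OF assms(1)] by auto
  have "piecewise_cont_bounded T (P r)" for r
    by (rule pcb_spike[OF variation_pcb[OF assms(1), of r] finite.emptyI]) (simp add: Q)
  moreover have "((\<lambda>r. P r t) has_real_derivative P' t) (at 0)" if "t \<in> {0..T} - (N \<union> N')" for t
    using N'(2)[of t] Q'[of t] that by (simp add: Q)
  moreover obtain L where "L \<ge> 0"
    "\<And>t r. t \<in> {0..T} \<Longrightarrow> \<bar>r\<bar> \<le> 1 \<Longrightarrow> \<bar>Q r t - Q 0 t\<bar> \<le> L * \<bar>r\<bar>"
    using variation_lipschitz[OF assms(1)] by auto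
  ultimately show ?thesis
    using \<open>finite N\<close> N'(1) Q by (intro variationI[where N = "N \<union> N'" and L = L]) auto
qed

section \<open>Variations under arithmetic, composition and absolute value\<close>

lemma variation_affine:
  assumes "piecewise_cont_bounded T a" "piecewise_cont_bounded T b"
  shows "variation T (\<lambda>r t. a t + r * b t) b"
proof -
  obtain M where M: "M \<ge> 0" "\<And>t. t \<in> {0..T} \<Longrightarrow> norm (b t) \<le> M"
    using pcb_bound[OF assms(2)] by auto
  have "piecewise_cont_bounded T (\<lambda>t. a t + r * b t)" for r
    by (intro pcb_add pcb_mult pcb_const assms)
  moreover have "\<bar>(a t + r * b t) - (a t + 0 * b t)\<bar> \<le> M * \<bar>r\<bar>" if "t \<in> {0..T}" for t r
    using mult_right_mono[OF M(2)[OF that], of "\<bar>r\<bar>"] by (simp add: abs_mult mult.commute)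
  moreover have "((\<lambda>r. a t + r * b t) has_real_derivative b t) (at 0)" for t
    by (auto intro!: derivative_eq_intros)
  ultimately show ?thesis
    by (intro variationI[where N = "{}" and L = M]) auto
qed

lemma variation_const:
  assumes "piecewise_cont_bounded T a"
  shows "variation T (\<lambda>r. a) (\<lambda>t. 0)"
  using variation_affine[OF assms pcb_const[of T 0]] by simp

lemma variation_add:
  assumes Q: "variation T Q Q'" and P: "variation T P P'"
  shows "variation T (\<lambda>r t. Q r t + P r t) (\<lambda>t. Q' t + P' t)"
proof -
  obtain L where L: "L \<ge> 0" "\<And>t r. t \<in> {0..T} \<Longrightarrow> \<bar>r\<bar> \<le> 1 \<Longrightarrow> \<bar>Q r t - Q 0 t\<bar> \<le> L * \<bar>r\<bar>"
    using variation_lipschitz[OF Q] by auto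
  obtain K where K: "K \<ge> 0" "\<And>t r. t \<in> {0..T} \<Longrightarrow> \<bar>r\<bar> \<le> 1 \<Longrightarrow> \<bar>P r t - P 0 t\<bar> \<le> K * \<bar>r\<bar>"
    using variation_lipschitz[OF P] by auto
  obtain N1 where N1: "finite N1"
    "\<And>t. t \<in> {0..T} - N1 \<Longrightarrow> ((\<lambda>r. Q r t) has_real_derivative Q' t) (at 0)"
    using variation_deriv[OF Q] by auto
  obtain N2 where N2: "finite N2"
    "\<And>t. t \<in> {0..T} - N2 \<Longrightarrow> ((\<lambda>r. P r t) has_real_derivative P' t) (at 0)"
    using variation_deriv[OF P] by auto
  have "piecewise_cont_bounded T (\<lambda>t. Q r t + P r t)" for r
    by (intro pcb_add variation_pcb[OF Q] variation_pcb[OF P])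
  moreover have "\<bar>(Q r t + P r t) - (Q 0 t + P 0 t)\<bar> \<le> (L + K) * \<bar>r\<bar>"
    if "t \<in> {0..T}" "\<bar>r\<bar> \<le> 1" for t r
    using L(2)[OF that] K(2)[OF that] by (simp add: algebra_simps)
  moreover have "((\<lambda>r. Q r t + P r t) has_real_derivative Q' t + P' t) (at 0)"
    if "t \<in> {0..T} - (N1 \<union> N2)" for t
    using that by (intro DERIV_add N1 N2) auto
  ultimately show ?thesis
    by (rule variationI[OF _ _ finite_UnI[OF N1(1) N2(1)]])
qed

lemma variation_mult:
  assumes Q: "variation T Q Q'" and P: "variation T P P'"
  shows "variation T (\<lambda>r t. Q r t * P r t) (\<lambda>t. Q' t * P 0 t + P' t * Q 0 t)"
proof -
  obtain L where L: "L \<ge> 0" "\<And>t r. t \<in> {0..T} \<Longrightarrow> \<bar>r\<bar> \<le> 1 \<Longrightarrow> \<bar>Q r t - Q 0 t\<bar> \<le> L * \<bar>r\<bar>"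
    using variation_lipschitz[OF Q] by auto
  obtain K where K: "K \<ge> 0" "\<And>t r. t \<in> {0..T} \<Longrightarrow> \<bar>r\<bar> \<le> 1 \<Longrightarrow> \<bar>P r t - P 0 t\<bar> \<le> K * \<bar>r\<bar>"
    using variation_lipschitz[OF P] by auto
  obtain A where A: "A \<ge> 0" "\<And>t r. t \<in> {0..T} \<Longrightarrow> \<bar>r\<bar> \<le> 1 \<Longrightarrow> \<bar>Q r t\<bar> \<le> A"
    using variation_bound[OF Q] by auto
  obtain B where B: "B \<ge> 0" "\<And>t r. t \<in> {0..T} \<Longrightarrow> \<bar>r\<bar> \<le> 1 \<Longrightarrow> \<bar>P r t\<bar> \<le> B"
    using variation_bound[OF P] by auto
  obtain N1 where N1: "finite N1"
    "\<And>t. t \<in> {0..T} - N1 \<Longrightarrow> ((\<lambda>r. Q r t) has_real_derivative Q' t) (at 0)"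
    using variation_deriv[OF Q] by auto
  obtain N2 where N2: "finite N2"
    "\<And>t. t \<in> {0..T} - N2 \<Longrightarrow> ((\<lambda>r. P r t) has_real_derivative P' t) (at 0)"
    using variation_deriv[OF P] by auto
  have "piecewise_cont_bounded T (\<lambda>t. Q r t * P r t)" for r
    by (intro pcb_mult variation_pcb[OF Q] variation_pcb[OF P])
  moreover have "\<bar>Q r t * P r t - Q 0 t * P 0 t\<bar> \<le> (L * B + A * K) * \<bar>r\<bar>"
    if "t \<in> {0..T}" "\<bar>r\<bar> \<le> 1" for t r
  proof -
    \<comment> \<open>Changing one factor at a time pairs each increment with a uniformly bounded
      factor, whence the constant \<open>L * B + A * K\<close>.\<close>
    have "Q r t * P r t - Q 0 t * P 0 t = (Q r t - Q 0 t) * P r t + Q 0 t * (P r t - P 0 t)"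
      by (simp add: algebra_simps)
    also have "\<bar>\<dots>\<bar> \<le> \<bar>Q r t - Q 0 t\<bar> * \<bar>P r t\<bar> + \<bar>Q 0 t\<bar> * \<bar>P r t - P 0 t\<bar>"
      by (metis abs_mult abs_triangle_ineq)
    also have "\<dots> \<le> (L * \<bar>r\<bar>) * B + A * (K * \<bar>r\<bar>)"
      by (intro add_mono mult_mono L(2) K(2) B A(2) A(1) that order_trans[OF abs_ge_zero L(2)[OF that]]) auto
    finally show ?thesis
      by (simp add: algebra_simps)
  qed
  moreover have "((\<lambda>r. Q r t * P r t) has_real_derivative Q' t * P 0 t + P' t * Q 0 t) (at 0)"
    if "t \<in> {0..T} - (N1 \<union> N2)" for t
    using that by (intro DERIV_mult N1 N2) auto
  ultimately show ?thesis
    by (rule variationI[OF _ _ finite_UnI[OF N1(1) N2(1)]])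
qed

lemma variation_cmult:
  assumes "variation T Q Q'"
  shows "variation T (\<lambda>r t. c * Q r t) (\<lambda>t. c * Q' t)"
  using variation_mult[OF variation_const[OF pcb_const[of T c]] assms]
  by (simp add: mult.commute)

lemma variation_diff:
  assumes "variation T Q Q'" "variation T P P'"
  shows "variation T (\<lambda>r t. Q r t - P r t) (\<lambda>t. Q' t - P' t)"
  using variation_add[OF assms(1) variation_cmult[OF assms(2), of "-1"]] by simp

lemma variation_power2:
  assumes "variation T Q Q'"
  shows "variation T (\<lambda>r t. (Q r t)\<^sup>2) (\<lambda>t. 2 * (Q 0 t * Q' t))"
  using variation_mult[OF assms assms] by (simp add: power2_eq_square mult.commute)

lemma variation_sum:
  assumes "\<And>i. i \<in> I \<Longrightarrow> variation T (Q i) (Q' i)"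
  shows "variation T (\<lambda>r t. \<Sum>i\<in>I. Q i r t) (\<lambda>t. \<Sum>i\<in>I. Q' i t)"
  using assms by (induction I rule: infinite_finite_induct)
    (auto intro: variation_const[OF pcb_const] variation_add)

text \<open>A C1 function need not be globally Lipschitz, but the uniform bound \<open>R\<close>
  confines all arguments to \<open>{-R..R}\<close>. There \<open>\<psi>'\<close> is bounded by some
  \<open>K\<close>, and the mean value inequality gives the constant \<open>K * L\<close>.\<close>

lemma variation_compose:
  assumes Q: "variation T Q Q'"
    and \<psi>: "\<And>s. (\<psi> has_real_derivative \<psi>' s) (at s)" and \<psi>': "continuous_on UNIV \<psi>'"
  shows "variation T (\<lambda>r t. \<psi> (Q r t)) (\<lambda>t. \<psi>' (Q 0 t) * Q' t)"
proof -
  obtain L where L: "L \<ge> 0" "\<And>t r. t \<in> {0..T} \<Longrightarrow> \<bar>r\<bar> \<le> 1 \<Longrightarrow> \<bar>Q r t - Q 0 t\<bar> \<le> L * \<bar>r\<bar>"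
    using variation_lipschitz[OF Q] by auto
  obtain R where R: "R \<ge> 0" "\<And>t r. t \<in> {0..T} \<Longrightarrow> \<bar>r\<bar> \<le> 1 \<Longrightarrow> \<bar>Q r t\<bar> \<le> R"
    using variation_bound[OF Q] by auto
  obtain N where N: "finite N"
    "\<And>t. t \<in> {0..T} - N \<Longrightarrow> ((\<lambda>r. Q r t) has_real_derivative Q' t) (at 0)"
    using variation_deriv[OF Q] by auto
  have "continuous_on {-R..R} \<psi>'"
    using \<psi>' by (rule continuous_on_subset) simp
  then have "bounded (\<psi>' ` {-R..R})"
    by (intro compact_imp_bounded compact_continuous_image compact_Icc)
  then obtain K where K: "\<forall>s\<in>{-R..R}. norm (\<psi>' s) \<le> K"
    by (auto simp: bounded_iff)
  have "continuous_on UNIV \<psi>"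
    by (rule DERIV_continuous_on) (use \<psi> in auto)
  then have "piecewise_cont_bounded T (\<lambda>t. \<psi> (Q r t))" for r
    by (rule pcb_compose[OF variation_pcb[OF Q]])
  moreover have "\<bar>\<psi> (Q r t) - \<psi> (Q 0 t)\<bar> \<le> (K * L) * \<bar>r\<bar>" if t: "t \<in> {0..T}" and r: "\<bar>r\<bar> \<le> 1" for t r
  proof -
    have mem: "Q r t \<in> {-R..R}" "Q 0 t \<in> {-R..R}"
      using R(2)[OF t r] R(2)[OF t, of 0] by auto
    have "norm (\<psi> (Q r t) - \<psi> (Q 0 t)) \<le> K * norm (Q r t - Q 0 t)"
      by (rule field_differentiable_bound[of "{-R..R}" \<psi> \<psi>'])
         (use mem K \<psi> in \<open>auto intro: has_field_derivative_at_within\<close>)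
    also have "\<dots> \<le> K * (L * \<bar>r\<bar>)"
      using L(2)[OF t r] order_trans[OF norm_ge_zero bspec[OF K mem(1)]] by (intro mult_left_mono) auto
    finally show ?thesis
      by simp
  qed
  moreover have "((\<lambda>r. \<psi> (Q r t)) has_real_derivative \<psi>' (Q 0 t) * Q' t) (at 0)"
    if "t \<in> {0..T} - N" for t
    by (rule DERIV_chain2[OF \<psi> N(2)[OF that]])
  ultimately show ?thesis
    by (rule variationI[OF _ _ N(1)])
qed

text \<open>The absolute value is 1-Lipschitz, so the constant \<open>L\<close> survives even at
  kinks. Differentiability is lost at most where \<open>Q 0 t\<close> vanishes, and these finitely
  many times join the exceptional set.\<close>

lemma variation_abs:
  assumes Q: "variation T Q Q'" and fin: "finite {t \<in> {0..T}. Q 0 t = 0}"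
  shows "variation T (\<lambda>r t. \<bar>Q r t\<bar>) (\<lambda>t. sgn (Q 0 t) * Q' t)"
proof -
  obtain L where L: "L \<ge> 0" "\<And>t r. t \<in> {0..T} \<Longrightarrow> \<bar>r\<bar> \<le> 1 \<Longrightarrow> \<bar>Q r t - Q 0 t\<bar> \<le> L * \<bar>r\<bar>"
    using variation_lipschitz[OF Q] by auto
  obtain N where N: "finite N"
    "\<And>t. t \<in> {0..T} - N \<Longrightarrow> ((\<lambda>r. Q r t) has_real_derivative Q' t) (at 0)"
    using variation_deriv[OF Q] by auto
  have "piecewise_cont_bounded T (\<lambda>t. \<bar>Q r t\<bar>)" for r
    by (rule pcb_compose[OF variation_pcb[OF Q]]) (intro continuous_intros)
  moreover have "\<bar>\<bar>Q r t\<bar> - \<bar>Q 0 t\<bar>\<bar> \<le> L * \<bar>r\<bar>" if "t \<in> {0..T}" "\<bar>r\<bar> \<le> 1" for t r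
    using L(2)[OF that] by linarith
  moreover have "((\<lambda>r. \<bar>Q r t\<bar>) has_real_derivative sgn (Q 0 t) * Q' t) (at 0)"
    if "t \<in> {0..T} - (N \<union> {t \<in> {0..T}. Q 0 t = 0})" for t
  proof (rule DERIV_chain2[of abs])
    show "(abs has_real_derivative sgn (Q 0 t)) (at (Q 0 t))"
      using GDERIV_norm[of "Q 0 t"] that by simp
  qed (use that N in auto)
  ultimately show ?thesis
    by (rule variationI[OF _ _ finite_UnI[OF N(1) fin]])
qed

text \<open>Dominated convergence for the difference quotients, with the constant \<open>L\<close>
  as the integrable majorant.\<close>

lemma variation_integral:
  assumes Q: "variation T Q Q'"
  shows "((\<lambda>r. integral {0..T} (Q r)) has_real_derivative integral {0..T} Q') (at 0)"
proof -
  obtain L where L: "L \<ge> 0" "\<And>t r. t \<in> {0..T} \<Longrightarrow> \<bar>r\<bar> \<le> 1 \<Longrightarrow> \<bar>Q r t - Q 0 t\<bar> \<le> L * \<bar>r\<bar>"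
    using variation_lipschitz[OF Q] by auto
  obtain N where N: "finite N"
    "\<And>t. t \<in> {0..T} - N \<Longrightarrow> ((\<lambda>r. Q r t) has_real_derivative Q' t) (at 0)"
    using variation_deriv[OF Q] by auto
  \<comment> \<open>On this set the quotients converge at every point, and the removed finite set
    does not change any integral.\<close>
  define I where "I = {0..T} - N"
  have I: "integral I f = integral {0..T} f" for f :: "real \<Rightarrow> real"
    unfolding I_def
  proof (rule integral_subset_negligible)
    have "{0..T} - ({0..T} - N) \<subseteq> N"
      by blast
    then show "negligible ({0..T} - ({0..T} - N))"
      by (rule negligible_finite[OF finite_subset[OF _ N(1)]])
  qed simp
  have integrable_I: "f integrable_on I" if "f integrable_on {0..T}" for f :: "real \<Rightarrow> real"
    using that by (simp only: I_def integrable_on_minus_finite[OF N(1)])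
  define q where "q = (\<lambda>r t. (Q r t - Q 0 t) / r)"
  have q: "q r integrable_on {0..T}" for r
    unfolding q_def divide_inverse
    by (intro pcb_integrable pcb_mult pcb_diff pcb_const variation_pcb[OF Q])
  have "((\<lambda>r. integral I (q r)) \<longlongrightarrow> integral I Q') (at 0)"
    unfolding tendsto_at_iff_sequentially comp_def
  proof (intro allI impI)
    fix X :: "nat \<Rightarrow> real" assume X0: "\<forall>i. X i \<in> UNIV - {0}" and X: "X \<longlonglongrightarrow> 0"
    \<comment> \<open>The Lipschitz bound holds only for \<open>\<bar>r\<bar> \<le> 1\<close>, so
      the sequence is shifted to start after its terms have become small.\<close>
    obtain n0 where n0: "\<And>n. n \<ge> n0 \<Longrightarrow> \<bar>X n\<bar> < 1"
      using LIMSEQ_D[OF X, of 1] by auto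
    have "(\<lambda>n. integral I (q (X (n + n0)))) \<longlonglongrightarrow> integral I Q'"
    proof (rule dominated_convergence(2))
      show "q (X (n + n0)) integrable_on I" for n
        by (intro integrable_I q)
      show "(\<lambda>t. L) integrable_on I"
        by (intro integrable_I integrable_const_ivl)
      show "norm (q (X (n + n0)) t) \<le> L" if "t \<in> I" for n t
        using L(2)[of t "X (n + n0)"] n0[of "n + n0"] X0 that
        by (auto simp: q_def I_def divide_le_eq)
      show "(\<lambda>n. q (X (n + n0)) t) \<longlonglongrightarrow> Q' t" if "t \<in> I" for t
      proof -
        have "((\<lambda>r. q r t) \<longlongrightarrow> Q' t) (at 0)"
          using N(2)[of t] that by (simp add: I_def q_def DERIV_def)
        then have "(\<lambda>n. q (X n) t) \<longlonglongrightarrow> Q' t"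
          using X X0 unfolding tendsto_at_iff_sequentially comp_def by blast
        then show ?thesis
          by (rule LIMSEQ_ignore_initial_segment)
      qed
    qed
    then show "(\<lambda>n. integral I (q (X n))) \<longlonglongrightarrow> integral I Q'"
      by (rule LIMSEQ_offset)
  qed
  \<comment> \<open>At \<open>r = 0\<close> both sides are 0, since division by zero yields
    0.\<close>
  moreover have "integral I (q r) = (integral {0..T} (Q r) - integral {0..T} (Q 0)) / r" for r
    by (simp add: I q_def integral_diff pcb_integrable variation_pcb[OF Q])
  ultimately show ?thesis
    by (simp add: DERIV_def I)
qed

section \<open>The controls\<close>

lemma surf_eq: "surf i x C b = C $ i \<bullet> x - b $ i"
  by (simp add: surf_def matrix_vector_mul_component)

text \<open>A derivative is unique, and a vector is determined by its inner products with all
  directions; hence the description in \<open>grad\<close> is well defined.\<close>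

lemma grad_eqI:
  assumes "GDERIV f x :> D"
  shows "grad f x = D"
  unfolding grad_def
proof (rule the_equality)
  show "GDERIV f x :> D"
    by (fact assms)
next
  fix D' assume "GDERIV f x :> D'"
  then have "(\<lambda>h. h \<bullet> D') = (\<lambda>h. h \<bullet> D)"
    using assms has_derivative_unique unfolding gderiv_def by blast
  then show "D' = D"
    by (simp add: fun_eq_iff vector_eq_ldot)
qed

lemma GDERIV_nth: "GDERIV (\<lambda>x::real^'n. x $ j) x :> axis j 1"
  unfolding gderiv_def inner_axis
  by (simp add: bounded_linear_imp_has_derivative bounded_linear_vec_nth)

lemma GDERIV_sum:
  assumes "\<And>i. i \<in> I \<Longrightarrow> GDERIV (f i) x :> D i"
  shows "GDERIV (\<lambda>y. \<Sum>i\<in>I. f i y) x :> (\<Sum>i\<in>I. D i)"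
  using assms unfolding gderiv_def inner_sum_right by (rule has_derivative_sum)

lemma GDERIV_norm1:
  fixes x :: "real^'n"
  assumes "\<And>j. x $ j \<noteq> 0"
  shows "GDERIV norm1 x :> (\<chi> j. sgn (x $ j))"
proof -
  have "(abs has_real_derivative sgn (x $ j)) (at (x $ j))" for j
    using GDERIV_norm[of "x $ j"] assms by simp
  from GDERIV_DERIV_compose[OF GDERIV_nth this]
  have "GDERIV (\<lambda>y::real^'n. \<bar>y $ j\<bar>) x :> sgn (x $ j) *\<^sub>R axis j 1" for j .
  then have "GDERIV (\<lambda>y::real^'n. \<Sum>j\<in>UNIV. \<bar>y $ j\<bar>) x :> (\<Sum>j\<in>UNIV. sgn (x $ j) *\<^sub>R axis j 1)"
    by (intro GDERIV_sum) auto
  moreover have "(\<Sum>j\<in>UNIV. sgn (x $ j) *\<^sub>R axis j 1) = (\<chi> j. sgn (x $ j))"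
    by (simp add: vec_eq_iff axis_def if_distrib cong: if_cong)
  ultimately show ?thesis
    by (simp add: norm1_def[abs_def])
qed

lemma GDERIV_surf_state: "GDERIV (\<lambda>y. surf i y C b) x :> C $ i"
  unfolding surf_eq gderiv_def
  by (auto intro!: derivative_eq_intros simp: inner_commute)

text \<open>Only row \<open>i\<close> of the matrix enters the \<open>i\<close>-th switching
  function, so the gradient is the matrix with row \<open>i\<close> equal to \<open>x\<close> and
  zeros elsewhere.\<close>

lemma GDERIV_surf_matrix: "GDERIV (\<lambda>D. surf i x D b) C :> axis i x"
  unfolding surf_eq gderiv_def inner_axis
  by (auto intro!: derivative_eq_intros bounded_linear_imp_has_derivative bounded_linear_vec_nth)

lemma GDERIV_surf_offset: "GDERIV (\<lambda>d. surf i x C d) b :> - axis i 1"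
  unfolding surf_eq gderiv_def
  by (auto intro!: derivative_eq_intros bounded_linear_imp_has_derivative bounded_linear_vec_nth
      simp: inner_axis)

section \<open>Smoothness of the control profiles\<close>

lemma control1_profile_deriv:
  "((\<lambda>s::real. - s * exp (- \<bar>s\<bar>)) has_real_derivative (\<bar>s\<bar> - 1) * exp (- \<bar>s\<bar>)) (at s)"
proof -
  consider "s > 0" | "s < 0" | "s = 0"
    by linarith
  then show ?thesis
  proof cases
    case 1
    have "((\<lambda>s::real. - s * exp (- s)) has_real_derivative (\<bar>s\<bar> - 1) * exp (- \<bar>s\<bar>)) (at s)"
      using 1 by (auto intro!: derivative_eq_intros simp: algebra_simps)
    then show ?thesis
      by (rule has_field_derivative_transform_within_open[of _ _ _ "{0<..}"]) (use 1 in auto)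
  next
    case 2
    have "((\<lambda>s::real. - s * exp s) has_real_derivative (\<bar>s\<bar> - 1) * exp (- \<bar>s\<bar>)) (at s)"
      using 2 by (auto intro!: derivative_eq_intros simp: algebra_simps)
    then show ?thesis
      by (rule has_field_derivative_transform_within_open[of _ _ _ "{..<0}"]) (use 2 in auto)
  next
    case 3
    \<comment> \<open>At the origin the factor \<open>s\<close> cancels against the increment, so
      the difference quotient is exactly \<open>- exp (- \<bar>h\<bar>)\<close>.\<close>
    have "((\<lambda>h::real. - exp (- \<bar>h\<bar>)) \<longlongrightarrow> - exp (- \<bar>0\<bar>)) (at 0)"
      by (intro tendsto_intros)
    moreover have "\<forall>\<^sub>F h::real in at 0. - exp (- \<bar>h\<bar>) = (- (0 + h) * exp (- \<bar>0 + h\<bar>) - - 0 * exp (- \<bar>0\<bar>)) / h"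
      by (auto simp: eventually_at_filter)
    ultimately have "((\<lambda>h::real. (- (0 + h) * exp (- \<bar>0 + h\<bar>) - - 0 * exp (- \<bar>0\<bar>)) / h) \<longlongrightarrow> - exp (- \<bar>0\<bar>)) (at 0)"
      by (rule Lim_transform_eventually)
    then show ?thesis
      using 3 by (simp add: DERIV_def)
  qed
qed

text \<open>The second control with the factor \<open>\<alpha> i * norm1 x\<close> split off, as a
  function of the switching value alone.\<close>

definition profile2 :: "real \<Rightarrow> real \<Rightarrow> real \<Rightarrow> real \<Rightarrow> real \<Rightarrow> real" where
  "profile2 \<delta> k e f s =
     (if s \<le> - \<delta> then k * sqrt (- s)
      else if s \<le> \<delta> then - (e * s ^ 3 + f * s)
      else - k * sqrt s)"

lemma control2_eq: "control2 \<alpha> \<delta> k e f i x C b = \<alpha> i * norm1 x * profile2 \<delta> k e f (surf i x C b)"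
  by (simp add: control2_def profile2_def Let_def algebra_simps)

text \<open>Restricting the control to the line \<open>s \<mapsto> ((1, \<dots>, 1), 0, - s e\<^sub>i)\<close>, on which no
  coordinate of the state vanishes and the switching function equals \<open>s\<close>, turns admissibility into
  smoothness of the profile.\<close>

lemma profile2_C1:
  fixes \<alpha> :: "'m::finite \<Rightarrow> real"
  assumes adm: "admissible_parameters \<alpha> \<delta> k e f TYPE('n::finite)" and \<alpha>: "\<alpha> i > 0"
  shows "\<exists>\<psi>'. (\<forall>s. (profile2 \<delta> k e f has_real_derivative \<psi>' s) (at s)) \<and> continuous_on UNIV \<psi>'"
proof -
  define F where "F = (\<lambda>(x :: real^'n, C :: real^'n^'m, b :: real^'m). control2 \<alpha> \<delta> k e f i x C b)"
  define S where "S = {(x :: real^'n, C :: real^'n^'m, b :: real^'m). \<forall>j. x $ j \<noteq> 0}"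
  obtain G where G: "continuous_on S G" "\<And>p. p \<in> S \<Longrightarrow> GDERIV F p :> G p"
    using adm unfolding admissible_parameters_def continuously_differentiable_on_def F_def S_def
    by blast
  define p where "p = (\<lambda>s. (1 :: real^'n, 0 :: real^'n^'m, (- s) *\<^sub>R axis i 1 :: real^'m))"
  \<comment> \<open>The value of the split-off factor on the chosen line. It is positive because
    \<alpha> is positive and the state space has at least one coordinate, so it can be divided
    out.\<close>
  define c where "c = \<alpha> i * norm1 (1 :: real^'n)"
  have "norm1 (1 :: real^'n) = real CARD('n)"
    by (simp add: norm1_def)
  then have "c > 0"
    using \<alpha> by (simp add: c_def)
  have pS: "p s \<in> S" for s
    by (simp add: p_def S_def)
  have Fp: "F (p s) = c * profile2 \<delta> k e f s" for s
    by (simp add: F_def p_def control2_eq surf_eq c_def)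
  have dp: "(p has_derivative (\<lambda>h. (0, 0, (- h) *\<^sub>R axis i 1))) (at s)" for s
    unfolding p_def by (auto intro!: derivative_eq_intros)
  have "((\<lambda>s. F (p s)) has_derivative (\<lambda>h. (0, 0, (- h) *\<^sub>R axis i 1) \<bullet> G (p s))) (at s)" for s
    using has_derivative_compose[OF dp] G(2)[OF pS] unfolding gderiv_def by blast
  moreover have "(\<lambda>h. (0 :: real^'n, 0 :: real^'n^'m, (- h) *\<^sub>R axis i 1) \<bullet> G (p s)) =
      (*) ((0, 0, - axis i 1) \<bullet> G (p s))" for s
    by (auto simp: inner_prod_def)
  ultimately have "((\<lambda>s. c * profile2 \<delta> k e f s) has_real_derivative (0, 0, - axis i 1) \<bullet> G (p s)) (at s)" for s
    by (simp add: has_field_derivative_def Fp)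
  then have "((\<lambda>s. inverse c * (c * profile2 \<delta> k e f s)) has_real_derivative
      inverse c * ((0, 0, - axis i 1) \<bullet> G (p s))) (at s)" for s
    by (rule DERIV_cmult)
  then have "(profile2 \<delta> k e f has_real_derivative inverse c * ((0, 0, - axis i 1) \<bullet> G (p s))) (at s)" for s
    using \<open>c > 0\<close> by (simp add: mult.assoc[symmetric])
  moreover have "continuous_on UNIV p"
    unfolding p_def by (intro continuous_intros)
  then have "continuous_on UNIV (\<lambda>s. inverse c * ((0, 0, - axis i 1) \<bullet> G (p s)))"
    by (intro continuous_intros continuous_on_compose2[OF G(1)]) (use pS in auto)
  ultimately show ?thesis
    by (intro exI conjI allI)
qed

text \<open>The common form of both controls. The gradient argument uses only this form, so the
  cases \<open>q = 1\<close> and \<open>q = 2\<close> are not distinguished again.\<close>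

locale factorized_control =
  fixes u :: "real^'n \<Rightarrow> real^'n^'m \<Rightarrow> real^'m \<Rightarrow> real" and a :: real and i :: 'm
    and \<psi> \<psi>' :: "real \<Rightarrow> real"
  assumes u_eq: "u x C b = a * norm1 x * \<psi> (surf i x C b)"
    and \<psi>: "(\<psi> has_real_derivative \<psi>' s) (at s)"
    and \<psi>'_cont: "continuous_on UNIV \<psi>'"

lemma control_factorization:
  fixes \<alpha> :: "'m::finite \<Rightarrow> real"
  assumes "q \<in> {1, 2}" and "admissible_parameters \<alpha> \<delta> k e f TYPE('n::finite)" and "\<alpha> i > 0"
  shows "\<exists>\<psi> \<psi>'. factorized_control
    (control q \<alpha> \<delta> k e f i :: real^'n \<Rightarrow> real^'n^'m \<Rightarrow> real^'m \<Rightarrow> real) (\<alpha> i) i \<psi> \<psi>'"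
proof (cases "q = 1")
  case True
  \<comment> \<open>The exponent of the first control is minus the absolute switching value, which
    gives the profile differentiated above.\<close>
  have "sgn s * - s = - \<bar>s\<bar>" for s :: real
    by (simp add: sgn_if)
  then have "control q \<alpha> \<delta> k e f i x C b = \<alpha> i * norm1 x * (- surf i x C b * exp (- \<bar>surf i x C b\<bar>))"
    for x :: "real^'n" and C b
    using True by (simp add: control_def control1_def)
  moreover have "continuous_on UNIV (\<lambda>s::real. (\<bar>s\<bar> - 1) * exp (- \<bar>s\<bar>))"
    by (intro continuous_intros)
  ultimately have "factorized_control (control q \<alpha> \<delta> k e f i :: real^'n \<Rightarrow> real^'n^'m \<Rightarrow> real^'m \<Rightarrow> real)
      (\<alpha> i) i (\<lambda>s. - s * exp (- \<bar>s\<bar>)) (\<lambda>s. (\<bar>s\<bar> - 1) * exp (- \<bar>s\<bar>))"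
    by (rule factorized_control.intro[OF _ control1_profile_deriv])
  then show ?thesis
    by blast
next
  case False
  obtain \<psi>' where \<psi>': "\<And>s. (profile2 \<delta> k e f has_real_derivative \<psi>' s) (at s)" "continuous_on UNIV \<psi>'"
    using profile2_C1[OF assms(2,3)] by auto
  have "control q \<alpha> \<delta> k e f i x C b = \<alpha> i * norm1 x * profile2 \<delta> k e f (surf i x C b)"
    for x :: "real^'n" and C b
    using False by (simp add: control_def control2_eq)
  then have "factorized_control (control q \<alpha> \<delta> k e f i :: real^'n \<Rightarrow> real^'n^'m \<Rightarrow> real^'m \<Rightarrow> real)
      (\<alpha> i) i (profile2 \<delta> k e f) \<psi>'"
    using \<psi>' by (rule factorized_control.intro)
  then show ?thesis
    by blast
qed

section \<open>Gradients and variation of a control along a trajectory\<close>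

context factorized_control
begin

lemma \<psi>_cont: "continuous_on UNIV \<psi>"
  by (rule DERIV_continuous_on) (use \<psi> in auto)

text \<open>Product and chain rule; the hypothesis keeps \<open>x\<close> away from the kinks of
  \<open>norm1\<close>.\<close>

lemma grad_state:
  assumes "\<And>j. x $ j \<noteq> 0"
  shows "grad (\<lambda>y. u y C b) x =
    a *\<^sub>R ((norm1 x * \<psi>' (surf i x C b)) *\<^sub>R C $ i + \<psi> (surf i x C b) *\<^sub>R (\<chi> j. sgn (x $ j)))"
proof (rule grad_eqI)
  have "GDERIV (\<lambda>y. norm1 y * \<psi> (surf i y C b)) x :>
      norm1 x *\<^sub>R (\<psi>' (surf i x C b) *\<^sub>R C $ i) + \<psi> (surf i x C b) *\<^sub>R (\<chi> j. sgn (x $ j))"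
    by (intro GDERIV_mult GDERIV_norm1 assms GDERIV_DERIV_compose[OF GDERIV_surf_state \<psi>])
  from GDERIV_mult[OF GDERIV_const[of a] this]
  show "GDERIV (\<lambda>y. u y C b) x :>
    a *\<^sub>R ((norm1 x * \<psi>' (surf i x C b)) *\<^sub>R C $ i + \<psi> (surf i x C b) *\<^sub>R (\<chi> j. sgn (x $ j)))"
    by (simp add: u_eq mult.assoc)
qed

text \<open>With \<open>x\<close> fixed, \<open>norm1 x\<close> is a constant factor and only the
  smooth profile is differentiated.\<close>

lemma grad_matrix:
  "grad (\<lambda>D. u x D b) C = (a * norm1 x * \<psi>' (surf i x C b)) *\<^sub>R axis i x"
proof (rule grad_eqI)
  from GDERIV_mult[OF GDERIV_const[of "a * norm1 x"] GDERIV_DERIV_compose[OF GDERIV_surf_matrix \<psi>]]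
  show "GDERIV (\<lambda>D. u x D b) C :> (a * norm1 x * \<psi>' (surf i x C b)) *\<^sub>R axis i x"
    by (simp add: u_eq)
qed

lemma grad_offset:
  "grad (\<lambda>d. u x C d) b = (- a * norm1 x * \<psi>' (surf i x C b)) *\<^sub>R axis i 1"
proof (rule grad_eqI)
  from GDERIV_mult[OF GDERIV_const[of "a * norm1 x"] GDERIV_DERIV_compose[OF GDERIV_surf_offset \<psi>]]
  show "GDERIV (\<lambda>d. u x C d) b :> (- a * norm1 x * \<psi>' (surf i x C b)) *\<^sub>R axis i 1"
    by (simp add: u_eq)
qed

context
  fixes T :: real and x :: "real \<Rightarrow> real^'n" and C :: "real^'n^'m" and b :: "real^'m"
  assumes x: "continuous_on {0..T} x"
    and x_zeros: "\<And>j. finite {t \<in> {0..T}. x t $ j = 0}"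
begin

lemma pcb_factors:
  "piecewise_cont_bounded T (\<lambda>t. norm1 (x t))"
  "piecewise_cont_bounded T (\<lambda>t. \<psi> (surf i (x t) C b))"
  "piecewise_cont_bounded T (\<lambda>t. \<psi>' (surf i (x t) C b))"
  unfolding norm1_def surf_eq
  by (intro pcb_continuous continuous_intros x continuous_on_compose2[OF \<psi>_cont]
      continuous_on_compose2[OF \<psi>'_cont]; simp)+

text \<open>The explicit formula holds except at the finitely many zeros of coordinates, and there
  the values of \<open>grad\<close> count only as spikes.\<close>

lemma pcb_grad_state: "piecewise_cont_bounded T (\<lambda>t. grad (\<lambda>y. u y C b) (x t))"
proof (rule pcb_spike)
  \<comment> \<open>Written as a sum of scaled axis vectors, the sign vector reduces to its scalar
    components.\<close>
  have "(\<chi> j. sgn (x t $ j)) = (\<Sum>j\<in>UNIV. sgn (x t $ j) *\<^sub>R axis j 1)" for t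
    by (simp add: vec_eq_iff axis_def if_distrib cong: if_cong)
  then have sgn: "piecewise_cont_bounded T (\<lambda>t. \<chi> j. sgn (x t $ j))"
    by (simp only:) (intro pcb_sum pcb_scaleR pcb_const pcb_sgn x_zeros continuous_intros x)
  show "piecewise_cont_bounded T (\<lambda>t. a *\<^sub>R ((norm1 (x t) * \<psi>' (surf i (x t) C b)) *\<^sub>R C $ i +
          \<psi> (surf i (x t) C b) *\<^sub>R (\<chi> j. sgn (x t $ j))))"
    by (intro pcb_add pcb_scaleR pcb_mult pcb_const pcb_factors sgn)
  show "finite (\<Union>j. {t \<in> {0..T}. x t $ j = 0})"
    using x_zeros by simp
qed (intro grad_state, auto)

lemma pcb_grad_matrix: "piecewise_cont_bounded T (\<lambda>t. grad (\<lambda>D. u (x t) D b) C)"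
proof -
  have axis: "axis i v = (\<chi> l. if l = i then v else 0)" for v :: "real^'n"
    by (simp add: vec_eq_iff axis_def)
  have "continuous_on {0..T} (\<lambda>t. if l = i then x t else 0)" for l
    using x by (cases "l = i") auto
  then have "piecewise_cont_bounded T (\<lambda>t. axis i (x t) :: real^'n^'m)"
    unfolding axis by (intro pcb_continuous continuous_on_vec_lambda)
  then show ?thesis
    unfolding grad_matrix by (intro pcb_scaleR pcb_mult pcb_const pcb_factors)
qed

lemma pcb_grad_offset: "piecewise_cont_bounded T (\<lambda>t. grad (\<lambda>d. u (x t) C d) b)"
  unfolding grad_offset by (intro pcb_scaleR pcb_mult pcb_const pcb_factors)

text \<open>The control is not differentiable at every time, so the chain rule for the whole is
  replaced by the calculus of variations of its parts: absolute values, products of entries, and the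
  profile. The resulting derivative is identified with the gradient formula off the zeros.\<close>

lemma variation_control:
  assumes y: "continuous_on {0..T} y"
  shows "variation T (\<lambda>r t. u (x t + r *\<^sub>R y t) (C + r *\<^sub>R D) (b + r *\<^sub>R d))
    (\<lambda>t. grad (\<lambda>y. u y C b) (x t) \<bullet> y t + grad (\<lambda>D. u (x t) D b) C \<bullet> D +
         grad (\<lambda>d. u (x t) C d) b \<bullet> d)"
proof -
  define s where "s = (\<lambda>t. surf i (x t) C b)"
  define s' where "s' = (\<lambda>t. (\<Sum>j\<in>UNIV. D $ i $ j * x t $ j + y t $ j * C $ i $ j) - d $ i)"
  have x_aff: "variation T (\<lambda>r t. x t $ j + r * y t $ j) (\<lambda>t. y t $ j)" for j
    by (intro variation_affine pcb_nth pcb_continuous x y)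
  have "variation T (\<lambda>r t. \<bar>x t $ j + r * y t $ j\<bar>) (\<lambda>t. sgn (x t $ j) * y t $ j)" for j
    using variation_abs[OF x_aff[of j]] x_zeros by simp
  from variation_sum[of UNIV, OF this]
  have N: "variation T (\<lambda>r t. norm1 (x t + r *\<^sub>R y t)) (\<lambda>t. \<Sum>j\<in>UNIV. sgn (x t $ j) * y t $ j)"
    by (simp add: norm1_def)
  \<comment> \<open>State and matrix move together, so each summand is a product of two affine
    functions of \<open>r\<close>. The terms with factor 0 are the other factor evaluated at
    \<open>r = 0\<close>.\<close>
  have "variation T (\<lambda>r t. (\<Sum>j\<in>UNIV. (C $ i $ j + r * D $ i $ j) * (x t $ j + r * y t $ j)) - (b $ i + r * d $ i))
     (\<lambda>t. (\<Sum>j\<in>UNIV. D $ i $ j * (x t $ j + 0 * y t $ j) + y t $ j * (C $ i $ j + 0 * D $ i $ j)) - d $ i)"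
    by (intro variation_diff variation_sum variation_mult x_aff variation_affine pcb_const)
  then have "variation T (\<lambda>r t. surf i (x t + r *\<^sub>R y t) (C + r *\<^sub>R D) (b + r *\<^sub>R d)) s'"
    by (simp add: surf_eq inner_vec_def s'_def)
  from variation_cmult[OF variation_mult[OF N variation_compose[OF this \<psi> \<psi>'_cont]], of a]
  have "variation T (\<lambda>r t. a * (norm1 (x t + r *\<^sub>R y t) * \<psi> (surf i (x t + r *\<^sub>R y t) (C + r *\<^sub>R D) (b + r *\<^sub>R d))))
     (\<lambda>t. a * ((\<Sum>j\<in>UNIV. sgn (x t $ j) * y t $ j) * \<psi> (s t) + \<psi>' (s t) * s' t * norm1 (x t)))"
    by (simp add: s_def)
  then show ?thesis
  proof (rule variation_cong)
    show "finite (\<Union>j. {t \<in> {0..T}. x t $ j = 0})"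
      using x_zeros by simp
  next
    fix t assume "t \<in> {0..T} - (\<Union>j. {t \<in> {0..T}. x t $ j = 0})"
    then have g: "grad (\<lambda>y. u y C b) (x t) =
        a *\<^sub>R ((norm1 (x t) * \<psi>' (s t)) *\<^sub>R C $ i + \<psi> (s t) *\<^sub>R (\<chi> j. sgn (x t $ j)))"
      unfolding s_def by (intro grad_state) auto
    have s': "s' t = D $ i \<bullet> x t + C $ i \<bullet> y t - d $ i"
      by (simp add: s'_def inner_vec_def sum.distrib mult.commute)
    have sg: "(\<Sum>j\<in>UNIV. sgn (x t $ j) * y t $ j) = (\<chi> j. sgn (x t $ j)) \<bullet> y t"
      by (simp add: inner_vec_def)
    show "grad (\<lambda>y. u y C b) (x t) \<bullet> y t + grad (\<lambda>D. u (x t) D b) C \<bullet> D + grad (\<lambda>d. u (x t) C d) b \<bullet> d =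
        a * ((\<Sum>j\<in>UNIV. sgn (x t $ j) * y t $ j) * \<psi> (s t) + \<psi>' (s t) * s' t * norm1 (x t))"
      unfolding g grad_matrix grad_offset sg s'
      by (simp add: s_def inner_add_left inner_axis inner_commute[of "axis _ _"] inner_commute[of "D $ i"] algebra_simps)
  qed (simp add: u_eq mult.assoc)
qed

end

end

section \<open>The gradient\<close>

text \<open>The zero set is closed in a compact interval, hence compact, and discreteness excludes
  limit points inside it; a compact set without such points is finite.\<close>

lemma finite_discrete_zeros:
  fixes f :: "real \<Rightarrow> real"
  assumes f: "continuous_on {0..T} f" and disc: "discrete {t \<in> {0..T}. f t = 0}"
  shows "finite {t \<in> {0..T}. f t = 0}"
proof -
  let ?Z = "{t \<in> {0..T}. f t = 0}"
  have "?Z = {0..T} \<inter> f -` {0}"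
    by auto
  moreover have "closed ({0..T} \<inter> f -` {0})"
    by (rule continuous_closed_preimage[OF f]) auto
  ultimately have "compact ?Z"
    using compact_Int_closed[OF compact_Icc[of 0 T], of ?Z] by (simp add: Int_absorb1 subset_iff)
  moreover have "\<not> t islimpt ?Z" if "t \<in> ?Z" for t
    using discreteD[OF disc that] by (simp add: isolated_in_islimpt_iff)
  ultimately have "finite (?Z \<inter> ?Z)"
    by (rule finite_not_islimpt_in_compact)
  then show ?thesis
    by simp
qed

section \<open>The trajectory and its variation\<close>

lemma trajectory_continuous:
  assumes "piecewise_cont_bounded T z"
  shows "continuous_on {0..T} (trajectory x0 z)"
  unfolding trajectory_def
  by (rule continuous_on_add[OF continuous_on_const
        indefinite_integral_continuous_1[OF pcb_integrable[OF assms]]])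

lemma trajectory_variation:
  assumes z: "piecewise_cont_bounded T z" and v: "piecewise_cont_bounded T v" and t: "t \<in> {0..T}"
  shows "trajectory x0 (\<lambda>t. z t + r *\<^sub>R v t) t = trajectory x0 z t + r *\<^sub>R integral {0..t} v"
proof -
  have "z integrable_on {0..t}" "v integrable_on {0..t}"
    using t by (auto intro: integrable_subinterval_real[OF pcb_integrable[OF z]]
        integrable_subinterval_real[OF pcb_integrable[OF v]])
  then have "integral {0..t} (\<lambda>t. z t + r *\<^sub>R v t) = integral {0..t} z + r *\<^sub>R integral {0..t} v"
    using integral_add[of z "{0..t}" "\<lambda>t. r *\<^sub>R v t"] by (simp add: integrable_cmul)
  then show ?thesis
    by (simp add: trajectory_def add.assoc)
qed

section \<open>Adjoint form of the first variation\<close>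

lemma pcb_adjoint:
  fixes w :: "real \<Rightarrow> real^'n"
  assumes "piecewise_cont_bounded T h" "piecewise_cont_bounded T w"
  shows "piecewise_cont_bounded T (\<lambda>t. h t *\<^sub>R axis k 1 - integral {t..T} (\<lambda>\<tau>. h \<tau> *\<^sub>R w \<tau>))"
  by (rule pcb_diff[OF pcb_scaleR[OF assms(1) pcb_const] pcb_integral_upper[OF pcb_scaleR[OF assms]]])

text \<open>Integration by parts with \<open>p = h w\<close> moves the state variation onto
  \<open>v\<close>. Both kinds of residual are covered: \<open>w\<close> is a row of
  \<open>A\<close>, with the state gradient of the control added in a controlled equation.\<close>

lemma has_integral_adjoint:
  fixes v w :: "real \<Rightarrow> real^'n"
  assumes "T \<ge> 0" and h: "piecewise_cont_bounded T h" and w: "piecewise_cont_bounded T w"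
    and v: "piecewise_cont_bounded T v"
  shows "((\<lambda>t. h t * (v t $ k - w t \<bullet> integral {0..t} v)) has_integral
    integral {0..T} (\<lambda>t. (h t *\<^sub>R axis k 1 - integral {t..T} (\<lambda>\<tau>. h \<tau> *\<^sub>R w \<tau>)) \<bullet> v t)) {0..T}"
proof -
  define p where "p = (\<lambda>t. h t *\<^sub>R w t)"
  have p: "piecewise_cont_bounded T p"
    unfolding p_def by (rule pcb_scaleR[OF h w])
  have y: "piecewise_cont_bounded T (\<lambda>t. integral {0..t} v)"
    by (rule pcb_continuous[OF indefinite_integral_continuous_1[OF pcb_integrable[OF v]]])
  note int_hv = pcb_integrable[OF pcb_mult[OF h pcb_nth[OF v, of k]]]
  note int_py = pcb_integrable[OF pcb_inner[OF p y]]
  note int_Pv = pcb_integrable[OF pcb_inner[OF pcb_integral_upper[OF p] v]]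
  have "((\<lambda>t. h t * v t $ k - p t \<bullet> integral {0..t} v) has_integral
      integral {0..T} (\<lambda>t. h t * v t $ k) - integral {0..T} (\<lambda>t. integral {t..T} p \<bullet> v t)) {0..T}"
    unfolding integral_inner_indefinite_integral[OF \<open>T \<ge> 0\<close> p v, symmetric]
    by (rule has_integral_diff[OF integrable_integral[OF int_hv] integrable_integral[OF int_py]])
  moreover have "integral {0..T} (\<lambda>t. h t * v t $ k) - integral {0..T} (\<lambda>t. integral {t..T} p \<bullet> v t) =
      integral {0..T} (\<lambda>t. (h t *\<^sub>R axis k 1 - integral {t..T} p) \<bullet> v t)"
    unfolding integral_diff[OF int_hv int_Pv, symmetric]
    by (simp add: inner_diff_left inner_axis inner_commute[of "axis _ _"])
  ultimately show ?thesis
    by (simp add: p_def right_diff_distrib)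
qed

lemma has_integral_inner_const:
  fixes f :: "real \<Rightarrow> 'a::euclidean_space"
  assumes "piecewise_cont_bounded T f"
  shows "((\<lambda>t. f t \<bullet> c) has_integral integral {0..T} f \<bullet> c) {0..T}"
  using has_integral_linear[OF integrable_integral[OF pcb_integrable[OF assms]] bounded_linear_inner_left, of c]
  by (simp add: o_def)


theorem theorem7p1:
  fixes q :: nat
    and \<iota> :: "'m::finite \<Rightarrow> 'n::finite"
    and A :: "real^'n^'n"
    and x0 :: "real^'n"
    and J :: "'n set" and xT :: "'n \<Rightarrow> real"
    and T \<delta> k e f :: real
    and \<alpha> :: "'m \<Rightarrow> real"
    and z :: "real \<Rightarrow> real^'n" and C :: "real^'n^'m" and b :: "real^'m"
  defines "u \<equiv> control q \<alpha> \<delta> k e f"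
    and "x \<equiv> trajectory x0 z"
  defines "h \<equiv> (\<lambda>i t. h_ctrl \<iota> A u i (x t) (z t) C b)"
    and "h' \<equiv> (\<lambda>j t. h_free A j (x t) (z t))"
  assumes "q \<in> {1, 2}"
    and "inj \<iota>"
    and "T > 0" and "\<delta> > 0" and "\<And>i. \<alpha> i > 0"
    and "admissible_parameters \<alpha> \<delta> k e f TYPE('n)"
    and "pc_bounded T z"
    and "\<And>j. discrete {t \<in> {0..T}. x t $ j = 0}"
  shows "has_gateaux_gradient T (functional_I T x0 J xT \<iota> A u) (z, C, b)
    (\<lambda>t. (\<Sum>i\<in>UNIV. h i t *\<^sub>R axis (\<iota> i) 1 -
             integral {t..T} (\<lambda>\<tau>. h i \<tau> *\<^sub>R (A $ \<iota> i + grad (\<lambda>y. u i y C b) (x \<tau>)))) +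
         (\<Sum>j\<in>- range \<iota>. h' j t *\<^sub>R axis j 1 - integral {t..T} (\<lambda>\<tau>. h' j \<tau> *\<^sub>R (A $ j))) +
         (\<Sum>j\<in>J. (x0 $ j + integral {0..T} (\<lambda>\<tau>. z \<tau> $ j) - xT j) *\<^sub>R axis j 1),
     \<Sum>i\<in>UNIV. - integral {0..T} (\<lambda>t. h i t *\<^sub>R grad (\<lambda>D. u i (x t) D b) C),
     \<Sum>i\<in>UNIV. - integral {0..T} (\<lambda>t. h i t *\<^sub>R grad (\<lambda>d. u i (x t) C d) b))"
proof -
  define gx where "gx = (\<lambda>i t. grad (\<lambda>y. u i y C b) (x t))"
  define gC where "gC = (\<lambda>i t. grad (\<lambda>D. u i (x t) D b) C)"
  define gb where "gb = (\<lambda>i t. grad (\<lambda>d. u i (x t) C d) b)"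
  \<comment> \<open>\<open>e1 i\<close> and \<open>e2 j\<close> are the contributions of single
    controlled and free equations to the \<open>z\<close>-gradient; \<open>c j\<close> is the
    terminal misfit.\<close>
  define e1 where "e1 = (\<lambda>i t. h i t *\<^sub>R axis (\<iota> i) 1 -
    integral {t..T} (\<lambda>\<tau>. h i \<tau> *\<^sub>R (A $ \<iota> i + gx i \<tau>)))"
  define e2 where "e2 = (\<lambda>j t. h' j t *\<^sub>R axis j 1 - integral {t..T} (\<lambda>\<tau>. h' j \<tau> *\<^sub>R (A $ j)))"
  define c where "c = (\<lambda>j. x0 $ j + integral {0..T} (\<lambda>\<tau>. z \<tau> $ j) - xT j)"
  define g where "g = (\<lambda>t. (\<Sum>i\<in>UNIV. e1 i t) + (\<Sum>j\<in>- range \<iota>. e2 j t) + (\<Sum>j\<in>J. c j *\<^sub>R axis j 1))"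
  have T: "T \<ge> 0"
    using \<open>T > 0\<close> by simp
  have z: "piecewise_cont_bounded T z"
    using \<open>pc_bounded T z\<close> by (simp add: pc_bounded_iff)
  have x: "continuous_on {0..T} x"
    unfolding x_def by (rule trajectory_continuous[OF z])
  have zeros: "finite {t \<in> {0..T}. x t $ j = 0}" for j
    by (rule finite_discrete_zeros[OF continuous_on_component[OF x] assms(12)])
  have "\<exists>\<psi> \<psi>'. factorized_control (u i) (\<alpha> i) i \<psi> \<psi>'" for i
    unfolding u_def by (rule control_factorization[OF assms(5,10,9)])
  then obtain \<psi> \<psi>' where fc: "\<And>i. factorized_control (u i) (\<alpha> i) i (\<psi> i) (\<psi>' i)"
    by metis
  have gx: "piecewise_cont_bounded T (gx i)" and gC: "piecewise_cont_bounded T (gC i)"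
    and gb: "piecewise_cont_bounded T (gb i)" for i
    unfolding gx_def gC_def gb_def
    by (rule factorized_control.pcb_grad_state[OF fc x zeros]
        factorized_control.pcb_grad_matrix[OF fc x zeros]
        factorized_control.pcb_grad_offset[OF fc x zeros])+
  \<comment> \<open>The linear part of the residual is affine in \<open>r\<close>. In the
    derivative, the row of \<open>A\<close> and the state gradient of the control combine into one
    coefficient of the state variation.\<close>
  have variation_h: "variation T
      (\<lambda>r t. h_ctrl \<iota> A u i (trajectory x0 (\<lambda>t. z t + r *\<^sub>R v t) t) (z t + r *\<^sub>R v t) (C + r *\<^sub>R D) (b + r *\<^sub>R d))
      (\<lambda>t. (v t $ \<iota> i - (A $ \<iota> i + gx i t) \<bullet> integral {0..t} v) - gC i t \<bullet> D - gb i t \<bullet> d)"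
    if v: "piecewise_cont_bounded T v" for v D d i
  proof -
    have y: "continuous_on {0..T} (\<lambda>t. integral {0..t} v)"
      by (rule indefinite_integral_continuous_1[OF pcb_integrable[OF v]])
    have "variation T (\<lambda>r t. (z t $ \<iota> i + r * v t $ \<iota> i) - (A $ \<iota> i \<bullet> x t + r * (A $ \<iota> i \<bullet> integral {0..t} v))
          - u i (x t + r *\<^sub>R integral {0..t} v) (C + r *\<^sub>R D) (b + r *\<^sub>R d))
        (\<lambda>t. v t $ \<iota> i - A $ \<iota> i \<bullet> integral {0..t} v -
          (gx i t \<bullet> integral {0..t} v + gC i t \<bullet> D + gb i t \<bullet> d))"
      unfolding gx_def gC_def gb_def
      by (rule variation_diff[OF variation_diff[OF variation_affine[OF pcb_nth[OF z] pcb_nth[OF v]]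
          variation_affine[OF pcb_inner[OF pcb_const pcb_continuous[OF x]] pcb_inner[OF pcb_const pcb_continuous[OF y]]]]
          factorized_control.variation_control[OF fc x zeros y]])
    then show ?thesis
      by (rule variation_cong[OF _ finite.emptyI])
        (simp_all add: h_ctrl_def trajectory_variation[OF z v] x_def inner_add_left inner_add_right)
  qed
  have variation_h': "variation T
      (\<lambda>r t. h_free A j (trajectory x0 (\<lambda>t. z t + r *\<^sub>R v t) t) (z t + r *\<^sub>R v t))
      (\<lambda>t. v t $ j - A $ j \<bullet> integral {0..t} v)"
    if v: "piecewise_cont_bounded T v" for v j
  proof -
    have y: "continuous_on {0..T} (\<lambda>t. integral {0..t} v)"
      by (rule indefinite_integral_continuous_1[OF pcb_integrable[OF v]])
    have "variation T (\<lambda>r t. (z t $ j + r * v t $ j) - (A $ j \<bullet> x t + r * (A $ j \<bullet> integral {0..t} v)))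
        (\<lambda>t. v t $ j - A $ j \<bullet> integral {0..t} v)"
      by (rule variation_diff[OF variation_affine[OF pcb_nth[OF z] pcb_nth[OF v]]
          variation_affine[OF pcb_inner[OF pcb_const pcb_continuous[OF x]] pcb_inner[OF pcb_const pcb_continuous[OF y]]]])
    then show ?thesis
      by (rule variation_cong[OF _ finite.emptyI])
        (simp_all add: h_free_def trajectory_variation[OF z v] x_def inner_add_right)
  qed
  \<comment> \<open>The zero direction at \<open>r = 0\<close> returns the original residual, so its
    regularity is contained in \<open>variation_h\<close>.\<close>
  have h: "piecewise_cont_bounded T (h i)" for i
    using variation_pcb[OF variation_h[OF pcb_const[of T 0]], where r = 0] by (simp add: h_def x_def)
  have h': "piecewise_cont_bounded T (h' j)" for j
    using variation_pcb[OF variation_h'[OF pcb_const[of T 0]], where r = 0] by (simp add: h'_def x_def)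
  have e1: "piecewise_cont_bounded T (e1 i)" for i
    unfolding e1_def by (rule pcb_adjoint[OF h pcb_add[OF pcb_const gx]])
  have e2: "piecewise_cont_bounded T (e2 j)" for j
    unfolding e2_def by (rule pcb_adjoint[OF h' pcb_const])
  have g: "piecewise_cont_bounded T g"
    unfolding g_def by (rule pcb_add[OF pcb_add[OF pcb_sum[OF e1] pcb_sum[OF e2]] pcb_const])
  have gateaux: "((\<lambda>r. (functional_I T x0 J xT \<iota> A u (\<lambda>t. z t + r *\<^sub>R v t) (C + r *\<^sub>R D) (b + r *\<^sub>R d) -
        functional_I T x0 J xT \<iota> A u z C b) / r) \<longlongrightarrow>
      integral {0..T} (\<lambda>t. g t \<bullet> v t) +
        (\<Sum>i\<in>UNIV. - integral {0..T} (\<lambda>t. h i t *\<^sub>R gC i t)) \<bullet> D +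
        (\<Sum>i\<in>UNIV. - integral {0..T} (\<lambda>t. h i t *\<^sub>R gb i t)) \<bullet> d) (at 0)"
    if "pc_bounded T v" for v D d
  proof -
    have v: "piecewise_cont_bounded T v"
      using that by (simp add: pc_bounded_iff)
    define H where "H = (\<lambda>i r t. h_ctrl \<iota> A u i (trajectory x0 (\<lambda>t. z t + r *\<^sub>R v t) t)
      (z t + r *\<^sub>R v t) (C + r *\<^sub>R D) (b + r *\<^sub>R d))"
    define H' where "H' = (\<lambda>j r t. h_free A j (trajectory x0 (\<lambda>t. z t + r *\<^sub>R v t) t) (z t + r *\<^sub>R v t))"
    have H0: "H i 0 = h i" for i
      by (simp add: H_def h_def x_def)
    have H'0: "H' j 0 = h' j" for j
      by (simp add: H'_def h'_def x_def)
    \<comment> \<open>Half the derivative of the integrated squared residual; the factor 2 from the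
      square later cancels against the 1/2 in the functional.\<close>
    define I1 where "I1 = (\<lambda>i. integral {0..T} (\<lambda>t. e1 i t \<bullet> v t) -
      integral {0..T} (\<lambda>t. h i t *\<^sub>R gC i t) \<bullet> D - integral {0..T} (\<lambda>t. h i t *\<^sub>R gb i t) \<bullet> d)"
    define I2 where "I2 = (\<lambda>j. integral {0..T} (\<lambda>t. e2 j t \<bullet> v t))"
    have dH: "((\<lambda>r. integral {0..T} (\<lambda>t. (H i r t)\<^sup>2)) has_real_derivative 2 * I1 i) (at 0)" for i
    proof -
      have "((\<lambda>t. h i t * (v t $ \<iota> i - (A $ \<iota> i + gx i t) \<bullet> integral {0..t} v)
          - (h i t *\<^sub>R gC i t) \<bullet> D - (h i t *\<^sub>R gb i t) \<bullet> d) has_integral I1 i) {0..T}"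
        unfolding I1_def e1_def
        by (rule has_integral_diff[OF has_integral_diff[OF
              has_integral_adjoint[OF T h pcb_add[OF pcb_const gx] v]
              has_integral_inner_const[OF pcb_scaleR[OF h gC]]]
              has_integral_inner_const[OF pcb_scaleR[OF h gb]]])
      from integral_unique[OF has_integral_mult_right[OF this, of 2]]
      have eq: "integral {0..T} (\<lambda>t. 2 * (H i 0 t * ((v t $ \<iota> i - (A $ \<iota> i + gx i t) \<bullet> integral {0..t} v)
          - gC i t \<bullet> D - gb i t \<bullet> d))) = 2 * I1 i"
        by (simp add: H0 right_diff_distrib)
      have "variation T (H i) (\<lambda>t. (v t $ \<iota> i - (A $ \<iota> i + gx i t) \<bullet> integral {0..t} v)
          - gC i t \<bullet> D - gb i t \<bullet> d)"
        unfolding H_def by (rule variation_h[OF v])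
      from variation_integral[OF variation_power2[OF this]]
      show ?thesis
        by (simp only: eq)
    qed
    have dH': "((\<lambda>r. integral {0..T} (\<lambda>t. (H' j r t)\<^sup>2)) has_real_derivative 2 * I2 j) (at 0)" for j
    proof -
      have "((\<lambda>t. h' j t * (v t $ j - A $ j \<bullet> integral {0..t} v)) has_integral I2 j) {0..T}"
        unfolding I2_def e2_def by (rule has_integral_adjoint[OF T h' pcb_const v])
      from integral_unique[OF has_integral_mult_right[OF this, of 2]]
      have eq: "integral {0..T} (\<lambda>t. 2 * (H' j 0 t * (v t $ j - A $ j \<bullet> integral {0..t} v))) = 2 * I2 j"
        by (simp add: H'0)
      have "variation T (H' j) (\<lambda>t. v t $ j - A $ j \<bullet> integral {0..t} v)"
        unfolding H'_def by (rule variation_h'[OF v])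
      from variation_integral[OF variation_power2[OF this]]
      show ?thesis
        by (simp only: eq)
    qed
    \<comment> \<open>The terminal misfit is affine in \<open>r\<close>, so its square is
      differentiated directly.\<close>
    have dchi: "((\<lambda>r. (x0 $ j + integral {0..T} (\<lambda>t. (z t + r *\<^sub>R v t) $ j) - xT j)\<^sup>2) has_real_derivative
        2 * (c j * integral {0..T} (\<lambda>t. v t $ j))) (at 0)" for j
    proof -
      have "integral {0..T} (\<lambda>t. (z t + r *\<^sub>R v t) $ j) =
          integral {0..T} (\<lambda>t. z t $ j) + r * integral {0..T} (\<lambda>t. v t $ j)" for r
        using integral_add[OF pcb_integrable[OF pcb_nth[OF z, of j]]
            pcb_integrable[OF pcb_mult[OF pcb_const[of T r] pcb_nth[OF v, of j]]]]
        by simp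
      then show ?thesis
        by (auto intro!: derivative_eq_intros simp: c_def)
    qed
    have "((\<lambda>r. functional_I T x0 J xT \<iota> A u (\<lambda>t. z t + r *\<^sub>R v t) (C + r *\<^sub>R D) (b + r *\<^sub>R d))
        has_real_derivative 1/2 * (\<Sum>i\<in>UNIV. 2 * I1 i) + 1/2 * (\<Sum>j\<in>- range \<iota>. 2 * I2 j)
          + 1/2 * (\<Sum>j\<in>J. 2 * (c j * integral {0..T} (\<lambda>t. v t $ j)))) (at 0)"
      unfolding functional_I_def phi_def chi_def
      by (intro DERIV_add DERIV_cmult DERIV_sum dchi dH[unfolded H_def] dH'[unfolded H'_def])
    moreover have "1/2 * (\<Sum>i\<in>UNIV. 2 * I1 i) + 1/2 * (\<Sum>j\<in>- range \<iota>. 2 * I2 j)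
          + 1/2 * (\<Sum>j\<in>J. 2 * (c j * integral {0..T} (\<lambda>t. v t $ j))) =
        integral {0..T} (\<lambda>t. g t \<bullet> v t) +
        (\<Sum>i\<in>UNIV. - integral {0..T} (\<lambda>t. h i t *\<^sub>R gC i t)) \<bullet> D +
        (\<Sum>i\<in>UNIV. - integral {0..T} (\<lambda>t. h i t *\<^sub>R gb i t)) \<bullet> d"
    proof -
      \<comment> \<open>Linearity of the integral gathers all terms containing \<open>v\<close> into
        the single pairing with \<open>g\<close>; the remaining parts of \<open>I1\<close> supply
        the pairings with \<open>D\<close> and \<open>d\<close>.\<close>
      have "((\<lambda>t. (\<Sum>i\<in>UNIV. e1 i t \<bullet> v t) + (\<Sum>j\<in>- range \<iota>. e2 j t \<bullet> v t) + (\<Sum>j\<in>J. c j * v t $ j))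
          has_integral (\<Sum>i\<in>UNIV. integral {0..T} (\<lambda>t. e1 i t \<bullet> v t)) + (\<Sum>j\<in>- range \<iota>. I2 j) +
            (\<Sum>j\<in>J. c j * integral {0..T} (\<lambda>t. v t $ j))) {0..T}"
        unfolding I2_def
        by (intro has_integral_add has_integral_sum has_integral_mult_right integrable_integral
            pcb_integrable pcb_inner e1 e2 v pcb_nth finite)
      moreover have "g t \<bullet> v t =
          (\<Sum>i\<in>UNIV. e1 i t \<bullet> v t) + (\<Sum>j\<in>- range \<iota>. e2 j t \<bullet> v t) + (\<Sum>j\<in>J. c j * v t $ j)" for t
        by (simp add: g_def inner_add_left inner_sum_left inner_axis inner_commute[of "axis _ _"])
      ultimately have "integral {0..T} (\<lambda>t. g t \<bullet> v t) =
          (\<Sum>i\<in>UNIV. integral {0..T} (\<lambda>t. e1 i t \<bullet> v t)) + (\<Sum>j\<in>- range \<iota>. I2 j) +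
            (\<Sum>j\<in>J. c j * integral {0..T} (\<lambda>t. v t $ j))"
        by (simp add: integral_unique)
      then show ?thesis
        by (simp add: I1_def sum_distrib_left[symmetric] sum_subtractf sum_negf inner_sum_left)
    qed
    ultimately show ?thesis
      by (simp add: DERIV_def)
  qed
  show ?thesis
    using g gateaux
    unfolding has_gateaux_gradient_def g_def e1_def e2_def c_def gx_def gC_def gb_def pc_bounded_iff
    by simp
qed

end
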